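(* Let $(R,\mathfrak m)$ be a Noetherian local integral domain of Krull dimension $1$, with $\mathfrak m$-adic completion $\hat R$. Then the following are equivalent: the map $R\to\hat R$ is Gaussian; the map $R\to\hat R$ is Ohm-Rush; $R$ is analytically irreducible.
   Context: All rings are commutative with identity. A Noetherian local ring $R$ is analytically irreducible if its completion $\hat R$ is an integral domain. For a ring $R$, an $R$-module $M$ and $f\in M$, the (Ohm-Rush) content of $f$ is the ideal $c(f):=\bigcap\{I\subseteq R \text{ ideal} \mid f\in IM\}$. A ring homomorphism $R\to S$ is Ohm-Rush if $f\in c(f)S$ for all $f\in S$ (viewing $S$ as an $R$-module). An Ohm-Rush algebra $R\to S$ is Gaussian if $S$ is faithfully flat over $R$ and $c(fg)=c(f)c(g)$ for all $f,g\in S$. *)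

theory Defs
  imports "HOL-Algebra.Algebra" "HOL-Library.Extended_Nat"
begin

definition local_ring :: "('a, 'r) ring_scheme \<Rightarrow> 'a set \<Rightarrow> bool" where
  "local_ring R \<mm> \<longleftrightarrow> cring R \<and> {I. maximalideal I R} = {\<mm>}"

definition krull_dim :: "('a, 'r) ring_scheme \<Rightarrow> enat" where
  "krull_dim R = Sup {enat n | n. \<exists>P :: nat \<Rightarrow> 'a set.
     (\<forall>i\<le>n. primeideal (P i) R) \<and> (\<forall>i<n. P i \<subset> P (Suc i))}"

abbreviation ideal_power :: "('a, 'r) ring_scheme \<Rightarrow> 'a set \<Rightarrow> nat \<Rightarrow> 'a set" where
  "ideal_power R I n \<equiv> I [^]\<^bsub>ideals_set R\<^esub> n"

text \<open>The inverse limit of the quotients \<open>R/I^n\<close>. The transition map from \<open>R/I^(n+1)\<close> to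
  \<open>R/I^n\<close> sends a coset to the unique coset containing it, so compatibility of a sequence
  is expressed by inclusion.\<close>

definition adic_completion :: "('a, 'r) ring_scheme \<Rightarrow> 'a set \<Rightarrow> (nat \<Rightarrow> 'a set) ring" where
  "adic_completion R I =
    \<lparr> carrier = {x. (\<forall>n. x n \<in> carrier (R Quot ideal_power R I n)) \<and> (\<forall>n. x (Suc n) \<subseteq> x n)},
      monoid.mult = (\<lambda>x y n. x n \<otimes>\<^bsub>R Quot ideal_power R I n\<^esub> y n),
      monoid.one = (\<lambda>n. \<one>\<^bsub>R Quot ideal_power R I n\<^esub>),
      ring.zero = (\<lambda>n. \<zero>\<^bsub>R Quot ideal_power R I n\<^esub>),
      ring.add = (\<lambda>x y n. x n \<oplus>\<^bsub>R Quot ideal_power R I n\<^esub> y n) \<rparr>"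

definition completion_map :: "('a, 'r) ring_scheme \<Rightarrow> 'a set \<Rightarrow> 'a \<Rightarrow> nat \<Rightarrow> 'a set" where
  "completion_map R I r = (\<lambda>n. ideal_power R I n +>\<^bsub>R\<^esub> r)"

definition analytically_irreducible :: "('a, 'r) ring_scheme \<Rightarrow> 'a set \<Rightarrow> bool" where
  "analytically_irreducible R \<mm> \<longleftrightarrow> domain (adic_completion R \<mm>)"

definition module_hom ::
  "('a, 'r) ring_scheme \<Rightarrow> ('a, 'b, 'p) module_scheme \<Rightarrow> ('a, 'c, 'q) module_scheme \<Rightarrow> ('b \<Rightarrow> 'c) set"
  where
  "module_hom R M N = {f \<in> hom (add_monoid M) (add_monoid N).
     \<forall>r\<in>carrier R. \<forall>x\<in>carrier M. f (r \<odot>\<^bsub>M\<^esub> x) = r \<odot>\<^bsub>N\<^esub> f x}"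

definition tensor_relations ::
  "('a, 'r) ring_scheme \<Rightarrow> ('a, 'b, 'p) module_scheme \<Rightarrow> ('a, 'c, 'q) module_scheme
    \<Rightarrow> ('b \<times> 'c \<Rightarrow>\<^sub>0 int) set" where
  "tensor_relations R M N =
     generate (free_Abelian_group (carrier M \<times> carrier N))
       ({frag_of (x \<oplus>\<^bsub>M\<^esub> x', y) - frag_of (x, y) - frag_of (x', y) | x x' y.
           x \<in> carrier M \<and> x' \<in> carrier M \<and> y \<in> carrier N} \<union>
        {frag_of (x, y \<oplus>\<^bsub>N\<^esub> y') - frag_of (x, y) - frag_of (x, y') | x y y'.
           x \<in> carrier M \<and> y \<in> carrier N \<and> y' \<in> carrier N} \<union>
        {frag_of (r \<odot>\<^bsub>M\<^esub> x, y) - frag_of (x, r \<odot>\<^bsub>N\<^esub> y) | r x y.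
           r \<in> carrier R \<and> x \<in> carrier M \<and> y \<in> carrier N})"

text \<open>Only the underlying abelian group of \<open>M \<otimes>\<^sub>R N\<close> is recorded (written multiplicatively, as a
  quotient group): exactness of a sequence of modules depends on nothing else.\<close>

definition tensor_group ::
  "('a, 'r) ring_scheme \<Rightarrow> ('a, 'b, 'p) module_scheme \<Rightarrow> ('a, 'c, 'q) module_scheme
    \<Rightarrow> ('b \<times> 'c \<Rightarrow>\<^sub>0 int) set monoid" where
  "tensor_group R M N =
     free_Abelian_group (carrier M \<times> carrier N) Mod tensor_relations R M N"

text \<open>The map \<open>f \<otimes> id\<close> from \<open>L \<otimes>\<^sub>R F\<close> to \<open>M \<otimes>\<^sub>R F\<close> induced by a module homomorphism \<open>f\<close> from \<open>L\<close> to \<open>M\<close>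
  (the image below is then a singleton for every coset \<open>C\<close> in \<open>L \<otimes>\<^sub>R F\<close>).\<close>

definition tensor_map ::
  "('a, 'r) ring_scheme \<Rightarrow> ('a, 'c, 'q) module_scheme \<Rightarrow> ('a, 'f, 's) module_scheme
    \<Rightarrow> ('b \<Rightarrow> 'c) \<Rightarrow> ('b \<times> 'f \<Rightarrow>\<^sub>0 int) set \<Rightarrow> ('c \<times> 'f \<Rightarrow>\<^sub>0 int) set" where
  "tensor_map R M F f C =
     the_elem ((\<lambda>u. r_coset (free_Abelian_group (carrier M \<times> carrier F)) (tensor_relations R M F)
                       (frag_extend (\<lambda>(x, y). frag_of (f x, y)) u)) ` C)"

text \<open>\<open>F\<close> is faithfully flat if a sequence \<open>L \<rightarrow> M \<rightarrow> N\<close> of \<open>R\<close>-modules is exact at \<open>M\<close> if and only if the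
  tensored sequence is exact at \<open>M \<otimes>\<^sub>R F\<close>. A HOL definition cannot quantify over types, so the type
  \<open>'m\<close> of module elements is an explicit parameter; the notion itself is faithful flatness with
  respect to all \<open>'m\<close>, obtained by leaving \<open>'m\<close> a type variable in a theorem.\<close>

definition faithfully_flat ::
  "'m itself \<Rightarrow> ('a, 'r) ring_scheme \<Rightarrow> ('a, 'f, 's) module_scheme \<Rightarrow> bool" where
  "faithfully_flat _ R F \<longleftrightarrow> module R F \<and>
    (\<forall>(L :: ('a, 'm) module) (M :: ('a, 'm) module) (N :: ('a, 'm) module) f g.
       module R L \<longrightarrow> module R M \<longrightarrow> module R N \<longrightarrow>
       f \<in> module_hom R L M \<longrightarrow> g \<in> module_hom R M N \<longrightarrow>
       (f ` carrier L = a_kernel M N g \<longleftrightarrow>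
        tensor_map R M F f ` carrier (tensor_group R L F) =
          kernel (tensor_group R M F) (tensor_group R N F) (tensor_map R N F g)))"

definition ideal_mult_module :: "'a set \<Rightarrow> ('a, 'b, 'p) module_scheme \<Rightarrow> 'b set" where
  "ideal_mult_module I M = generate (add_monoid M) {a \<odot>\<^bsub>M\<^esub> x | a x. a \<in> I \<and> x \<in> carrier M}"

definition content ::
  "('a, 'r) ring_scheme \<Rightarrow> ('a, 'b, 'p) module_scheme \<Rightarrow> 'b \<Rightarrow> 'a set" where
  "content R M f = \<Inter>{I. ideal I R \<and> f \<in> ideal_mult_module I M}"

definition restrict_scalars :: "('b, 's) ring_scheme \<Rightarrow> ('a \<Rightarrow> 'b) \<Rightarrow> ('a, 'b) module" where
  "restrict_scalars S \<phi> =
    \<lparr> carrier = carrier S, monoid.mult = monoid.mult S, monoid.one = \<one>\<^bsub>S\<^esub>,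
      ring.zero = \<zero>\<^bsub>S\<^esub>, ring.add = ring.add S,
      smult = (\<lambda>r s. \<phi> r \<otimes>\<^bsub>S\<^esub> s) \<rparr>"

definition ohm_rush ::
  "('a, 'r) ring_scheme \<Rightarrow> ('b, 's) ring_scheme \<Rightarrow> ('a \<Rightarrow> 'b) \<Rightarrow> bool" where
  "ohm_rush R S \<phi> \<longleftrightarrow> cring R \<and> cring S \<and> \<phi> \<in> ring_hom R S \<and>
    (\<forall>f\<in>carrier S. f \<in> ideal_mult_module (content R (restrict_scalars S \<phi>) f) (restrict_scalars S \<phi>))"

definition gaussian ::
  "'m itself \<Rightarrow> ('a, 'r) ring_scheme \<Rightarrow> ('b, 's) ring_scheme \<Rightarrow> ('a \<Rightarrow> 'b) \<Rightarrow> bool" where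
  "gaussian u R S \<phi> \<longleftrightarrow> ohm_rush R S \<phi> \<and> faithfully_flat u R (restrict_scalars S \<phi>) \<and>
    (\<forall>f\<in>carrier S. \<forall>g\<in>carrier S.
       content R (restrict_scalars S \<phi>) (f \<otimes>\<^bsub>S\<^esub> g) =
       content R (restrict_scalars S \<phi>) f \<cdot>\<^bsub>R\<^esub> content R (restrict_scalars S \<phi>) g)"

end

(*
  In dimension one every nonzero ideal of R contains a power of the maximal ideal m, so for nonzero
  c in R the completion S satisfies S = R + cS, the intersection of R with cS is cR, and c is regular
  on S. All three conditions turn out to be equivalent to: every nonzero f in S is a unit times an
  element r of R. Such an f has content rR, which gives Ohm-Rush and multiplicativity of contents.
  If R -> S is Ohm-Rush, f is nonzero, c is a nonzero element of its content I and a in m is nonzero,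
  then f = r + acs with r in I, hence I lies in rR + acR; so c is in rR by Nakayama, and f is r times
  a unit. If S is a domain, chain conditions in R modulo a give a^j in fS for some j, and then
  f = r + a^(j+1)s is a unit multiple of r as well.

  S is always faithfully flat: S/R is a vector space over the fraction field of R, so any finite subset
  of S lies in a free submodule having 1 in a basis.
*)
theory Submission
  imports Defs
begin

section \<open>One-dimensional Noetherian local domains\<close>

text \<open>S enters only as an inverse limit, so finiteness has to be pulled back to R. Since S = R
  + aS, an ideal of S is visible in R only modulo a; what stabilises in R therefore determines
  ideals of S up to an error in aS. Iterating on this error and summing the resulting a-adic series
  in S removes it. Inverses of the elements 1 + as come from the same kind of series. For flatness
  the difficulty is that S need not be free, while a tensor is a class of formal sums modulo a large
  group of relations. A relation is witnessed by finitely many elements of S, so it suffices to have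
  coordinates on a part of S containing them. They are functions on all of S whose linearity is
  asked for on that part alone; evaluating a formal sum along such a function gives an element of
  the module, and exactness is checked coordinate by coordinate.\<close>

text \<open>The ascending chain condition as an induction: an infinite strictly ascending sequence
  of ideals is a chain, so its union is one of its members and swallows the next term.\<close>

lemma (in noetherian_ring) ideal_induct [consumes 1, case_names step]:
  assumes "ideal I R"
    and step: "\<And>I. ideal I R \<Longrightarrow> (\<And>J. ideal J R \<Longrightarrow> I \<subset> J \<Longrightarrow> P J) \<Longrightarrow> P I"
  shows "P I"
proof -
  let ?r = "{(J, I). ideal I R \<and> ideal J R \<and> I \<subset> J}"
  have "wf ?r"
    unfolding wf_iff_no_infinite_down_chain
  proof
    assume "\<exists>f. \<forall>i. (f (Suc i), f i) \<in> ?r"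
    then obtain f where f: "\<forall>i. ideal (f i) R" "\<forall>i. f i \<subset> f (Suc i)"
      unfolding mem_Collect_eq case_prod_conv by blast
    have "f i \<subseteq> f j" if "i \<le> j" for i j
      using lift_Suc_mono_le[of f, OF _ that] f(2) by blast
    then have "f i \<subseteq> f j \<or> f j \<subseteq> f i" for i j by (metis linear)
    then have "subset.chain {I. ideal I R} (range f)"
      unfolding pred_on.chain_def using f(1) by blast
    then have "\<Union>(range f) \<in> range f" by (intro ideal_chain_is_trivial) auto
    then obtain n where "\<Union>(range f) = f n" by auto
    then have "f (Suc n) \<subseteq> f n" by blast
    with f(2) show False by blast
  qed
  then show ?thesis using \<open>ideal I R\<close>
  proof (induction I rule: wf_induct_rule)
    case (less I)
    show ?case by (rule step[OF less.prems]) (use less in blast)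
  qed
qed

lemma (in noetherian_ring) ex_maximalideal:
  assumes "ideal I R" "I \<noteq> carrier R"
  shows "\<exists>M. maximalideal M R \<and> I \<subseteq> M"
  using assms
proof (induction I rule: ideal_induct)
  case (step I)
  show ?case
  proof (cases "maximalideal I R")
    case False
    then obtain J where "ideal J R" "I \<subseteq> J" "J \<noteq> I" "J \<noteq> carrier R"
      using step by (metis maximalidealI)
    then show ?thesis using step(2)[of J] by blast
  qed auto
qed

section \<open>Powers of ideals, sums with principal ideals, colon ideals\<close>

lemma (in cring) ideal_power_ideal:
  assumes "ideal I R"
  shows "ideal (ideal_power R I n) R"
proof -
  interpret J: semiring "ideals_set R" by (rule ideals_set_is_semiring)
  have "I \<in> carrier (ideals_set R)" using assms by (simp add: ideals_set_def)
  then have "ideal_power R I n \<in> carrier (ideals_set R)" by simp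
  then show ?thesis by (simp add: ideals_set_def)
qed

lemma (in cring) ideal_power_0: "ideal_power R I 0 = carrier R"
  by (simp add: ideals_set_def)

lemma (in cring) ideal_power_add:
  assumes "ideal I R"
  shows "ideal_power R I (m + n) = ideal_power R I m \<cdot> ideal_power R I n"
proof -
  interpret J: semiring "ideals_set R" by (rule ideals_set_is_semiring)
  have "I \<in> carrier (ideals_set R)" using assms by (simp add: ideals_set_def)
  then show ?thesis
    using J.nat_pow_mult[of I m n] by (simp add: ideals_set_def)
qed

lemma (in cring) ideal_power_1:
  assumes "ideal I R"
  shows "ideal_power R I 1 = I"
proof -
  interpret J: semiring "ideals_set R" by (rule ideals_set_is_semiring)
  have "I \<in> carrier (ideals_set R)" using assms by (simp add: ideals_set_def)
  then show ?thesis using J.nat_pow_eone[of I] by simp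
qed

lemma (in cring) ideal_power_mono:
  assumes "ideal I R" "m \<le> n"
  shows "ideal_power R I n \<subseteq> ideal_power R I m"
proof -
  have "ideal_power R I n = ideal_power R I m \<cdot> ideal_power R I (n - m)"
    using ideal_power_add[OF assms(1), of m "n - m"] assms(2) by simp
  then show ?thesis
    using ideal_prod_inter[OF ideal_power_ideal ideal_power_ideal, OF assms(1) assms(1)] by blast
qed

lemma (in cring) pow_in_ideal_power:
  assumes "ideal I R" "a \<in> I"
  shows "a [^] n \<in> ideal_power R I n"
proof (induction n)
  case 0 then show ?case by (simp add: ideals_set_def)
next
  case (Suc n)
  have "a [^] n \<otimes> a \<in> ideal_power R I n \<cdot> ideal_power R I 1"
    using Suc assms by (intro ideal_prod.prod) (simp_all only: ideal_power_1)
  then show ?case using ideal_power_add[OF assms(1), of n 1] by simp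
qed

lemma (in cring) ideal_sum_principal:
  assumes "ideal I R" "a \<in> carrier R"
  shows "ideal (I <+>\<^bsub>R\<^esub> PIdl a) R" "I \<subseteq> I <+>\<^bsub>R\<^esub> PIdl a" "a \<in> I <+>\<^bsub>R\<^esub> PIdl a"
proof -
  interpret I: ideal I R by fact
  have P: "ideal (PIdl a) R" using assms by (simp add: cgenideal_ideal)
  interpret P: ideal "PIdl a" R by fact
  show "ideal (I <+>\<^bsub>R\<^esub> PIdl a) R" using assms P by (intro add_ideals)
  show "I \<subseteq> I <+>\<^bsub>R\<^esub> PIdl a"
  proof
    fix x assume "x \<in> I"
    then have "x = x \<oplus> \<zero>" "\<zero> \<in> PIdl a" by auto
    then show "x \<in> I <+>\<^bsub>R\<^esub> PIdl a" unfolding set_add_def' using \<open>x \<in> I\<close> by blast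
  qed
  have "a = \<zero> \<oplus> a" "a \<in> PIdl a" using assms cgenideal_self by auto
  then show "a \<in> I <+>\<^bsub>R\<^esub> PIdl a" unfolding set_add_def' using I.zero_closed by blast
qed

text \<open>The colon ideal I : a. Together with I + (a) it measures an ideal in two pieces, which
  drives the descending chain argument in R; over S it gives the multiplier ideals.\<close>

lemma (in cring) ideal_quotient_ideal:
  assumes "ideal I R" "a \<in> carrier R"
  shows "ideal {x \<in> carrier R. x \<otimes> a \<in> I} R"
proof -
  interpret I: ideal I R by fact
  show ?thesis
  proof (rule idealI[OF ring_axioms])
    show "subgroup {x \<in> carrier R. x \<otimes> a \<in> I} (add_monoid R)"
      using assms by (intro add.subgroupI) (auto simp: l_distr l_minus simp flip: a_inv_def)
  qed (use assms in \<open>auto simp: m_assoc m_comm[of _ a] m_lcomm I.I_l_closed\<close>, metis I.I_l_closed m_comm m_lcomm m_closed)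
qed

section \<open>Primes and chain conditions in dimension one\<close>

locale one_dim_local_domain = noetherian_domain R for R (structure) +
  fixes \<mm> :: "'a set"
  assumes local: "local_ring R \<mm>" and dim: "krull_dim R = 1"
begin

lemma max_maximal: "maximalideal \<mm> R"
  using local by (auto simp: local_ring_def)

lemma max_ideal: "ideal \<mm> R"
  using max_maximal by (simp add: maximalideal_def)

lemma max_prime: "primeideal \<mm> R"
  using max_maximal by (rule maximalideal_prime)

lemma proper_ideal_subset_max:
  assumes "ideal I R" "I \<noteq> carrier R"
  shows "I \<subseteq> \<mm>"
  using ex_maximalideal[OF assms] local by (auto simp: local_ring_def)

lemma unit_if_notin_max:
  assumes "x \<in> carrier R" "x \<notin> \<mm>"
  shows "x \<in> Units R"
proof -
  have "PIdl x = carrier R"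
    using proper_ideal_subset_max[of "PIdl x"] cgenideal_ideal[of x] cgenideal_self[of x] assms by blast
  then show ?thesis using ideal_eq_carrier_iff[of x] assms by blast
qed

text \<open>The upper bound on \<open>krull_dim R\<close> enters the proof here, the lower bound in
  \<open>max_nonzero\<close>; later arguments see the dimension through these two facts.\<close>

lemma prime_cases:
  assumes "primeideal P R"
  shows "P = {\<zero>} \<or> P = \<mm>"
proof (rule ccontr)
  assume neg: "\<not> ?thesis"
  interpret P: primeideal P R by fact
  have z: "{\<zero>} \<subset> P" using neg P.zero_closed by auto
  have m: "P \<subset> \<mm>" using neg proper_ideal_subset_max[OF P.is_ideal] P.I_notcarr by blast
  let ?c = "\<lambda>i::nat. if i = 0 then {\<zero>} else if i = 1 then P else \<mm>"
  have "(\<forall>i\<le>2. primeideal (?c i) R) \<and> (\<forall>i<2. ?c i \<subset> ?c (Suc i))"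
    using zeroprimeideal assms max_prime z m by (auto simp: less_Suc_eq numeral_2_eq_2)
  then have "enat 2 \<le> krull_dim R"
    unfolding krull_dim_def
    by (intro Sup_upper CollectI exI[of _ "2::nat"] conjI[OF refl]) (rule exI[of _ ?c])
  then show False using dim by (simp add: one_enat_def)
qed

lemma max_nonzero: "\<mm> \<noteq> {\<zero>}"
proof
  assume m: "\<mm> = {\<zero>}"
  have "krull_dim R \<le> 0"
    unfolding krull_dim_def
  proof (rule Sup_least, clarify)
    fix n and P :: "nat \<Rightarrow> 'a set"
    assume P: "\<forall>i\<le>n. primeideal (P i) R" "\<forall>i<n. P i \<subset> P (Suc i)"
    have "n = 0"
    proof (rule ccontr)
      assume "n \<noteq> 0"
      then have "P 0 \<subset> P 1" "P 0 = {\<zero>}" "P 1 = {\<zero>}" using P prime_cases m by auto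
      then show False by blast
    qed
    then show "enat n \<le> 0" by (simp add: zero_enat_def)
  qed
  then show False using dim by simp
qed

text \<open>By \<open>prime_cases\<close> a nonzero ideal other than R and \<mm> is not prime, which
  supplies a and b; I + (a) and I + (b) are then strictly larger than I. The rule does the work of
  an induction on the length of R/I.\<close>

lemma nonzero_ideal_induct [consumes 2, case_names carrier max split]:
  assumes "ideal I R" "I \<noteq> {\<zero>}"
    and carrier: "Q (carrier R)" and max: "Q \<mm>"
    and split: "\<And>I a b. \<lbrakk>ideal I R; I \<noteq> {\<zero>}; a \<in> carrier R; b \<in> carrier R; a \<otimes> b \<in> I; a \<notin> I; b \<notin> I;
        \<And>J. ideal J R \<Longrightarrow> I \<subset> J \<Longrightarrow> Q J\<rbrakk> \<Longrightarrow> Q I"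
  shows "Q I"
  using assms(1,2)
proof (induction I rule: ideal_induct)
  case (step I)
  have bigger: "Q J" if "ideal J R" "I \<subset> J" for J
  proof -
    have "\<zero> \<in> I" using step(1) by (simp add: additive_subgroup.zero_closed ideal.axioms(1))
    then have "J \<noteq> {\<zero>}" using that step.prems by auto
    then show ?thesis using step that by blast
  qed
  show ?case
  proof (cases "I = carrier R \<or> I = \<mm>")
    case False
    then have "\<not> primeideal I R" using prime_cases step.prems by blast
    then obtain a b where "a \<in> carrier R" "b \<in> carrier R" "a \<otimes> b \<in> I" "a \<notin> I" "b \<notin> I"
      using primeidealI[OF step(1) is_cring] False by blast
    then show ?thesis using split[OF step(1) step.prems] bigger by blast
  qed (use carrier max in auto)
qed

text \<open>In the split case the product of I + (a) and I + (b) lies in I because ab does, so the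
  two exponents add up.\<close>

lemma max_power_subset:
  assumes "ideal I R" "I \<noteq> {\<zero>}"
  shows "\<exists>k. ideal_power R \<mm> k \<subseteq> I"
  using assms
proof (induction I rule: nonzero_ideal_induct)
  case carrier
  show ?case using ideal_power_0 by blast
next
  case max
  show ?case using ideal_power_1[OF max_ideal] by blast
next
  case (split I a b)
  interpret I: ideal I R by fact
  let ?A = "I <+>\<^bsub>R\<^esub> PIdl a" and ?B = "I <+>\<^bsub>R\<^esub> PIdl b"
  note A = ideal_sum_principal[OF split(1,3)] and B = ideal_sum_principal[OF split(1,4)]
  have "I \<subset> ?A" "I \<subset> ?B" using A(2,3) B(2,3) split.hyps by blast+
  then obtain i j where ij: "ideal_power R \<mm> i \<subseteq> ?A" "ideal_power R \<mm> j \<subseteq> ?B"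
    using split(8) A(1) B(1) by meson
  have AB: "x \<otimes> y \<in> I" if "x \<in> ?A" "y \<in> ?B" for x y
  proof -
    obtain u r v s where x: "x = u \<oplus> r \<otimes> a" "u \<in> I" "r \<in> carrier R"
      and y: "y = v \<oplus> s \<otimes> b" "v \<in> I" "s \<in> carrier R"
      using \<open>x \<in> ?A\<close> \<open>y \<in> ?B\<close> unfolding set_add_def' cgenideal_def by auto
    have c: "u \<in> carrier R" "v \<in> carrier R" using x y by auto
    have "x \<otimes> y = u \<otimes> y \<oplus> (v \<otimes> (r \<otimes> a) \<oplus> (r \<otimes> s) \<otimes> (a \<otimes> b))"
      using x y c split.hyps by (simp add: l_distr r_distr m_ac a_ac)
    moreover have "y \<in> carrier R" using y c split.hyps by simp
    ultimately show ?thesis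
      using x y split.hyps by (simp add: I.I_l_closed I.I_r_closed)
  qed
  have "x \<in> I" if "x \<in> ideal_power R \<mm> i \<cdot> ideal_power R \<mm> j" for x
    using that
  proof (induction rule: ideal_prod.induct)
    case (prod i j)
    then show ?case using AB ij by blast
  qed simp
  then show ?case using ideal_power_add[OF max_ideal, of i j] by blast
qed

text \<open>R/I is Artinian. In the split case nested ideals J' \<subseteq> J are equal as soon as
  J' + (a) = J + (a) and J' : a = J : a. The sums all contain I + (a), and the colon ideals contain
  I + (b) because ab is in I, so induction applies to both derived chains.\<close>

lemma descending_chain_stabilises:
  assumes "ideal I R" "I \<noteq> {\<zero>}"
    and "\<And>n. ideal (J n) R" "\<And>n. I \<subseteq> J n" "\<And>n. J (Suc n) \<subseteq> J n"
  shows "\<exists>N. \<forall>n\<ge>N. J n = J N"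
  using assms
proof (induction I arbitrary: J rule: nonzero_ideal_induct)
  case carrier
  have "J n = carrier R" for n
    using carrier(2)[of n] ideal.Icarr[OF carrier(1), of _ n] by blast
  then show ?case by auto
next
  case max
  interpret maximalideal \<mm> R by (rule max_maximal)
  have two: "J n = \<mm> \<or> J n = carrier R" for n
    using I_maximal[OF max(1)[of n] max(2)[of n]] ideal.Icarr[OF max(1), of _ n] by blast
  show ?case
  proof (cases "\<exists>N. J N = \<mm>")
    case True
    then obtain N where N: "J N = \<mm>" by blast
    have "J n = \<mm>" if "n \<ge> N" for n
      using lift_Suc_antimono_le[of J, OF max(3) that] N max(2)[of n] by blast
    then show ?thesis using N by auto
  next
    case False
    then show ?thesis using two by metis
  qed
next
  case (split I a b)
  let ?A = "I <+>\<^bsub>R\<^esub> PIdl a" and ?B = "I <+>\<^bsub>R\<^esub> PIdl b"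
  note A = ideal_sum_principal[OF split(1,3)] and B = ideal_sum_principal[OF split(1,4)]
  have AB: "I \<subset> ?A" "I \<subset> ?B" using A(2,3) B(2,3) split.hyps by blast+
  let ?S = "\<lambda>n. J n <+>\<^bsub>R\<^esub> PIdl a" and ?Q = "\<lambda>n. {x \<in> carrier R. x \<otimes> a \<in> J n}"
  have S: "\<And>n. ideal (?S n) R" "\<And>n. ?A \<subseteq> ?S n" "\<And>n. ?S (Suc n) \<subseteq> ?S n"
    using ideal_sum_principal(1)[OF split.prems(1) split(3)] split.prems(2,3)
    unfolding set_add_def' by blast+
  have Q: "\<And>n. ideal (?Q n) R" "\<And>n. ?B \<subseteq> ?Q n" "\<And>n. ?Q (Suc n) \<subseteq> ?Q n"
  proof -
    fix n
    interpret I: ideal I R by fact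
    show "ideal (?Q n) R" by (rule ideal_quotient_ideal[OF split.prems(1) split(3)])
    have "?B \<subseteq> {x \<in> carrier R. x \<otimes> a \<in> I}"
    proof
      fix x assume "x \<in> ?B"
      then obtain v s where y: "x = v \<oplus> s \<otimes> b" "v \<in> I" "s \<in> carrier R"
        unfolding set_add_def' cgenideal_def by auto
      have v: "v \<in> carrier R" using y by auto
      have "x \<otimes> a = v \<otimes> a \<oplus> s \<otimes> (a \<otimes> b)" using y v split.hyps by (simp add: l_distr r_distr m_ac a_ac)
      then show "x \<in> {x \<in> carrier R. x \<otimes> a \<in> I}"
        using y v split.hyps by (simp add: I.I_l_closed I.I_r_closed)
    qed
    then show "?B \<subseteq> ?Q n" using split.prems(2)[of n] by blast
    show "?Q (Suc n) \<subseteq> ?Q n" using split.prems(3)[of n] by blast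
  qed
  obtain N1 where N1: "\<And>n. n \<ge> N1 \<Longrightarrow> ?S n = ?S N1"
    using split.IH(1)[OF A(1) AB(1), of ?S] S by blast
  obtain N2 where N2: "\<And>n. n \<ge> N2 \<Longrightarrow> ?Q n = ?Q N2"
    using split.IH(1)[OF B(1) AB(2), of ?Q] Q by blast
  let ?N = "max N1 N2"
  have "J n = J ?N" if n: "n \<ge> ?N" for n
  proof
    show le: "J n \<subseteq> J ?N" using lift_Suc_antimono_le[of J, OF split.prems(3) n] .
    interpret N: ideal "J ?N" R by (rule split.prems)
    interpret n: ideal "J n" R by (rule split.prems)
    show "J ?N \<subseteq> J n"
    proof
      fix x assume x: "x \<in> J ?N"
      have "?S n = ?S ?N" using N1[of n] N1[of ?N] n by simp
      then have "x \<in> ?S n"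
        using x ideal_sum_principal(2)[OF split.prems(1) split(3)] by blast
      then obtain y r where y: "x = y \<oplus> r \<otimes> a" "y \<in> J n" "r \<in> carrier R"
        unfolding set_add_def' cgenideal_def by auto
      have cc: "x \<in> carrier R" "y \<in> carrier R" using x y by auto
      have "r \<otimes> a = x \<ominus> y" using y cc split.hyps by (simp add: a_minus_def a_ac r_neg1 r_neg2)
      moreover have "x \<ominus> y \<in> J ?N" using x y le by (auto simp: a_minus_def)
      ultimately have "r \<in> ?Q ?N" using y by simp
      also have "?Q ?N = ?Q n" using N2[of n] N2[of ?N] n by simp
      finally show "x \<in> J n" using y by auto
    qed
  qed
  then show ?case by blast
qed

end

section \<open>The completion\<close>

lemma (in abelian_group) add_diff_cancel:
  assumes "x \<in> carrier G" "y \<in> carrier G"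
  shows "x \<oplus> y \<ominus> x = y" "x \<oplus> (y \<ominus> x) = y" "(y \<ominus> x) \<oplus> x = y"
  using assms r_neg1[of x y] r_neg2[of x y] by (simp_all add: a_minus_def a_ac)

section \<open>Cauchy sequences as representatives\<close>

context one_dim_local_domain
begin

abbreviation completion (\<open>S\<close>) where "S \<equiv> adic_completion R \<mm>"

abbreviation to_completion (\<open>\<phi>\<close>) where "\<phi> \<equiv> completion_map R \<mm>"

abbreviation max_power (\<open>P\<close>) where "P n \<equiv> ideal_power R \<mm> n"

text \<open>The rate of convergence is built in: \<open>r n\<close> represents the limit modulo
  \<open>P n\<close>. Every element of the inverse limit has such a sequence of representatives, and
  arithmetic in S becomes pointwise.\<close>

definition cauchy :: "(nat \<Rightarrow> 'a) \<Rightarrow> bool" where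
  "cauchy r \<longleftrightarrow> (\<forall>n. r n \<in> carrier R \<and> r (Suc n) \<ominus> r n \<in> P n)"

definition adic_limit :: "(nat \<Rightarrow> 'a) \<Rightarrow> nat \<Rightarrow> 'a set" where
  "adic_limit r = (\<lambda>n. P n +> r n)"

lemma P_ideal: "ideal (P n) R"
  by (rule ideal_power_ideal[OF max_ideal])

lemma P_carrier: "x \<in> P n \<Longrightarrow> x \<in> carrier R"
  using ideal.Icarr[OF P_ideal] .

lemma P_mono: "m \<le> n \<Longrightarrow> x \<in> P n \<Longrightarrow> x \<in> P m"
  using ideal_power_mono[OF max_ideal] by blast

lemma P_add: "x \<in> P n \<Longrightarrow> y \<in> P n \<Longrightarrow> x \<oplus> y \<in> P n"
  by (meson P_ideal additive_subgroup.a_closed ideal_def)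

lemma P_zero: "\<zero> \<in> P n"
  by (meson P_ideal additive_subgroup.zero_closed ideal_def)

lemma P_minus: "x \<in> P n \<Longrightarrow> \<ominus> x \<in> P n"
  by (meson P_ideal additive_subgroup.a_inv_closed ideal_def abelian_group_axioms)

lemma P_mult: "x \<in> P n \<Longrightarrow> r \<in> carrier R \<Longrightarrow> r \<otimes> x \<in> P n"
  by (rule ideal.I_l_closed[OF P_ideal])

lemma coset_eq_iff:
  "a \<in> carrier R \<Longrightarrow> b \<in> carrier R \<Longrightarrow> P n +> a = P n +> b \<longleftrightarrow> a \<ominus> b \<in> P n"
  using quotient_eq_iff_same_a_r_cos[OF P_ideal] by blast

lemma P_diff_trans:
  assumes "a \<ominus> b \<in> P n" "b \<ominus> c \<in> P n" "a \<in> carrier R" "b \<in> carrier R" "c \<in> carrier R"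
  shows "a \<ominus> c \<in> P n"
  using coset_eq_iff[of a b n] coset_eq_iff[of b c n] coset_eq_iff[of a c n] assms by simp

text \<open>Translates the compatibility condition of the inverse limit, an inclusion of cosets,
  into a congruence of representatives.\<close>

lemma coset_subset_iff:
  assumes "a \<in> carrier R" "b \<in> carrier R"
  shows "P (Suc n) +> a \<subseteq> P n +> b \<longleftrightarrow> a \<ominus> b \<in> P n"
proof
  interpret n: ideal "P n" R by (rule P_ideal)
  interpret s: ideal "P (Suc n)" R by (rule P_ideal)
  {
    assume "P (Suc n) +> a \<subseteq> P n +> b"
    then have "a \<in> P n +> b" using s.a_rcos_self[OF assms(1)] by (rule subsetD)
    then show "a \<ominus> b \<in> P n" using n.a_rcos_module_imp assms by (simp add: a_minus_def)
  }
  assume "a \<ominus> b \<in> P n"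
  then have "P n +> a = P n +> b" using assms by (simp add: coset_eq_iff)
  moreover have "P (Suc n) +> a \<subseteq> P n +> a"
    using P_mono[of n "Suc n"] unfolding a_r_coset_def' by auto
  ultimately show "P (Suc n) +> a \<subseteq> P n +> b" by simp
qed

lemma quotient_cring: "cring (R Quot P n)"
  by (rule ideal.quotient_is_cring[OF P_ideal is_cring])

lemma completion_carrier: "carrier S = adic_limit ` Collect cauchy"
proof (intro equalityI subsetI)
  fix x assume x: "x \<in> carrier S"
  have "\<forall>n. \<exists>r\<in>carrier R. x n = P n +> r"
    using x by (auto simp: adic_completion_def FactRing_def A_RCOSETS_def' )
  then obtain r where r: "\<And>n. r n \<in> carrier R" "\<And>n. x n = P n +> r n" by metis
  have "x (Suc n) \<subseteq> x n" for n using x by (auto simp: adic_completion_def)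
  then have "cauchy r" unfolding cauchy_def using r coset_subset_iff by auto
  moreover have "x = adic_limit r" using r by (auto simp: adic_limit_def)
  ultimately show "x \<in> adic_limit ` Collect cauchy" by blast
next
  fix x assume "x \<in> adic_limit ` Collect cauchy"
  then obtain r where r: "x = adic_limit r" "cauchy r" by blast
  have "x (Suc n) \<subseteq> x n" for n
    using r coset_subset_iff[of "r (Suc n)" "r n" n] unfolding adic_limit_def cauchy_def by blast
  moreover have "x n \<in> carrier (R Quot P n)" for n
    using r by (auto simp: adic_limit_def cauchy_def FactRing_def A_RCOSETS_def')
  ultimately show "x \<in> carrier S"
    by (simp add: adic_completion_def)
qed

lemma completion_rep:
  assumes "x \<in> carrier S"
  obtains r where "cauchy r" "x = adic_limit r"
  using assms completion_carrier by blast

lemma adic_limit_closed: "cauchy r \<Longrightarrow> adic_limit r \<in> carrier S"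
  using completion_carrier by blast

lemma cauchy_carrier: "cauchy r \<Longrightarrow> r n \<in> carrier R"
  by (simp add: cauchy_def)

lemma cauchy_const: "a \<in> carrier R \<Longrightarrow> cauchy (\<lambda>_. a)"
  by (simp add: cauchy_def a_minus_def r_neg P_zero)

lemma to_completion_eq: "\<phi> a = adic_limit (\<lambda>_. a)"
  by (simp add: completion_map_def adic_limit_def)

lemma adic_limit_eq_iff:
  assumes "cauchy r" "cauchy s"
  shows "adic_limit r = adic_limit s \<longleftrightarrow> (\<forall>n. r n \<ominus> s n \<in> P n)"
  using assms by (simp add: adic_limit_def fun_eq_iff cauchy_def coset_eq_iff)

lemma cauchy_step:
  assumes "cauchy r"
  shows "r (n + k) \<ominus> r n \<in> P n"
proof (induction k)
  case 0 then show ?case using assms by (simp add: cauchy_def a_minus_def r_neg P_zero)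
next
  case (Suc k)
  have "r (Suc (n + k)) \<ominus> r (n + k) \<in> P n" using assms P_mono[of n "n + k"] by (simp add: cauchy_def)
  from P_diff_trans[OF this Suc] show ?case using assms by (simp add: cauchy_def)
qed

lemma cauchy_add:
  assumes "cauchy r" "cauchy s"
  shows "cauchy (\<lambda>n. r n \<oplus> s n)"
  unfolding cauchy_def
proof (intro allI conjI)
  fix n
  have c: "r n \<in> carrier R" "s n \<in> carrier R" "r (Suc n) \<in> carrier R" "s (Suc n) \<in> carrier R"
    using assms by (auto simp: cauchy_def)
  then show "r n \<oplus> s n \<in> carrier R" by simp
  have "(r (Suc n) \<oplus> s (Suc n)) \<ominus> (r n \<oplus> s n) = (r (Suc n) \<ominus> r n) \<oplus> (s (Suc n) \<ominus> s n)"
    using c by (simp add: a_minus_def minus_add a_ac)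
  then show "(r (Suc n) \<oplus> s (Suc n)) \<ominus> (r n \<oplus> s n) \<in> P n"
    using assms by (simp add: cauchy_def P_add)
qed

lemma cauchy_mult:
  assumes "cauchy r" "cauchy s"
  shows "cauchy (\<lambda>n. r n \<otimes> s n)"
  unfolding cauchy_def
proof (intro allI conjI)
  fix n
  have c: "r n \<in> carrier R" "s n \<in> carrier R" "r (Suc n) \<in> carrier R" "s (Suc n) \<in> carrier R"
    using assms by (auto simp: cauchy_def)
  then show "r n \<otimes> s n \<in> carrier R" by simp
  have "r (Suc n) \<otimes> s (Suc n) \<ominus> r n \<otimes> s (Suc n) = s (Suc n) \<otimes> (r (Suc n) \<ominus> r n)"
    "r n \<otimes> s (Suc n) \<ominus> r n \<otimes> s n = r n \<otimes> (s (Suc n) \<ominus> s n)"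
    using c by (simp_all add: a_minus_def r_distr r_minus m_ac)
  then show "(r (Suc n) \<otimes> s (Suc n)) \<ominus> (r n \<otimes> s n) \<in> P n"
    using assms c P_diff_trans[of _ "r n \<otimes> s (Suc n)"] by (simp add: cauchy_def P_mult)
qed

lemma cauchy_uminus:
  assumes "cauchy r"
  shows "cauchy (\<lambda>n. \<ominus> r n)"
  unfolding cauchy_def
proof (intro allI conjI)
  fix n
  have c: "r n \<in> carrier R" "r (Suc n) \<in> carrier R"
    using assms by (auto simp: cauchy_def)
  then show "\<ominus> r n \<in> carrier R" by simp
  have "\<ominus> r (Suc n) \<ominus> (\<ominus> r n) = \<ominus> (r (Suc n) \<ominus> r n)"
    using c by (simp add: a_minus_def minus_add)
  then show "\<ominus> r (Suc n) \<ominus> (\<ominus> r n) \<in> P n"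
    using assms c by (simp add: cauchy_def P_minus)
qed

lemma completion_add:
  assumes "cauchy r" "cauchy s"
  shows "adic_limit r \<oplus>\<^bsub>S\<^esub> adic_limit s = adic_limit (\<lambda>n. r n \<oplus> s n)"
  using assms ideal.a_rcos_sum[OF P_ideal]
  by (simp add: adic_completion_def adic_limit_def FactRing_def cauchy_def)

lemma completion_mult:
  assumes "cauchy r" "cauchy s"
  shows "adic_limit r \<otimes>\<^bsub>S\<^esub> adic_limit s = adic_limit (\<lambda>n. r n \<otimes> s n)"
  using assms ideal.rcoset_mult_add[OF P_ideal]
  by (simp add: adic_completion_def adic_limit_def FactRing_def cauchy_def)

lemma completion_one: "\<one>\<^bsub>S\<^esub> = \<phi> \<one>"
  by (simp add: adic_completion_def completion_map_def FactRing_def)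

lemma completion_zero: "\<zero>\<^bsub>S\<^esub> = \<phi> \<zero>"
  using a_rcos_zero[OF P_ideal P_zero]
  by (simp add: adic_completion_def completion_map_def FactRing_def)

lemmas completion_simps = completion_add completion_mult completion_one completion_zero
  to_completion_eq cauchy_add cauchy_mult cauchy_const cauchy_carrier adic_limit_closed

lemma completion_cring: "cring S"
proof (intro cringI abelian_groupI comm_monoidI)
  fix x assume x: "x \<in> carrier S"
  then obtain r where r: "cauchy r" "x = adic_limit r" by (rule completion_rep)
  have "adic_limit (\<lambda>n. \<ominus> r n) \<oplus>\<^bsub>S\<^esub> x = \<zero>\<^bsub>S\<^esub>"
    using r by (simp add: completion_simps cauchy_uminus l_neg)
  then show "\<exists>y\<in>carrier S. y \<oplus>\<^bsub>S\<^esub> x = \<zero>\<^bsub>S\<^esub>"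
    using cauchy_uminus[OF r(1)] adic_limit_closed by blast
qed (auto elim!: completion_rep simp: completion_simps a_ac m_ac l_distr r_distr)

sublocale S: cring S by (rule completion_cring)

lemma to_completion_hom: "\<phi> \<in> ring_hom R S"
  by (rule ring_hom_memI) (auto simp: completion_simps)

sublocale \<phi>: ring_hom_cring R S \<phi>
  by (rule ring_hom_cring.intro[OF is_cring completion_cring])
    (simp add: ring_hom_cring_axioms_def to_completion_hom)

section \<open>Division by nonzero elements of R\<close>

text \<open>Division by c costs a fixed number k of steps of precision; shifting the sequence by k
  pays for it without changing the limit.\<close>

lemma adic_limit_shift:
  assumes "cauchy r"
  shows "cauchy (\<lambda>n. r (k + n))" "adic_limit (\<lambda>n. r (k + n)) = adic_limit r"
proof -
  show *: "cauchy (\<lambda>n. r (k + n))"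
    using assms P_mono[OF le_add2] unfolding cauchy_def add_Suc_right by blast
  show "adic_limit (\<lambda>n. r (k + n)) = adic_limit r"
    using cauchy_step[OF assms, of _ k] adic_limit_eq_iff[OF * assms] by (simp add: add.commute)
qed

text \<open>Some power \<open>P k\<close> lies in (c), and \<open>P (k + i)\<close> is the product
  of \<open>P k\<close> and \<open>P i\<close>. The loss k does not depend on i, so quotients of
  null sequences by c are again null sequences.\<close>

lemma conductor:
  assumes "c \<in> carrier R" "c \<noteq> \<zero>"
  obtains k where "P k \<subseteq> PIdl c" "\<And>i x. x \<in> P (k + i) \<Longrightarrow> \<exists>d\<in>P i. x = c \<otimes> d"
proof -
  have "PIdl c \<noteq> {\<zero>}" using cgenideal_self[of c] assms by blast
  then obtain k where k: "P k \<subseteq> PIdl c"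
    using max_power_subset[OF cgenideal_ideal] assms by blast
  have "\<exists>d\<in>P i. x = c \<otimes> d" if "x \<in> P (k + i)" for i x
  proof -
    have "x \<in> P k \<cdot> P i" using that ideal_power_add[OF max_ideal] by simp
    then show ?thesis
    proof (induction rule: ideal_prod.induct)
      case (prod u v)
      then obtain y where y: "u = y \<otimes> c" "y \<in> carrier R" using k by (auto simp: cgenideal_def)
      then have "u \<otimes> v = c \<otimes> (y \<otimes> v)" using prod assms P_carrier by (simp add: m_ac)
      then show ?case using P_mult prod y by blast
    next
      case (sum s1 s2)
      then obtain d e where "d \<in> P i" "s1 = c \<otimes> d" "e \<in> P i" "s2 = c \<otimes> e" by blast
      then have "s1 \<oplus> s2 = c \<otimes> (d \<oplus> e)" "d \<oplus> e \<in> P i"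
        using assms P_carrier P_add by (simp_all add: r_distr)
      then show ?case by blast
    qed
  qed
  with k show thesis by (rule that)
qed

text \<open>From index k on, the increments of a representing sequence are divisible by c with
  quotients \<open>d i\<close> in \<open>P i\<close>. The partial sums \<open>T\<close> of these
  quotients converge to t, and r is the k-th term of the sequence.\<close>

lemma completion_dense:
  assumes "c \<in> carrier R" "c \<noteq> \<zero>" "s \<in> carrier S"
  obtains r t where "r \<in> carrier R" "t \<in> carrier S" "s = \<phi> r \<oplus>\<^bsub>S\<^esub> \<phi> c \<otimes>\<^bsub>S\<^esub> t"
proof -
  obtain k where k: "\<And>i x. x \<in> P (k + i) \<Longrightarrow> \<exists>d\<in>P i. x = c \<otimes> d"
    using conductor[OF assms(1,2)] by metis
  obtain r where r: "cauchy r" "s = adic_limit r" using assms(3) by (rule completion_rep)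
  have rc: "r n \<in> carrier R" for n using r(1) by (rule cauchy_carrier)
  have "\<forall>i. \<exists>d\<in>P i. r (Suc (k + i)) \<ominus> r (k + i) = c \<otimes> d"
    using k r(1) by (auto simp: cauchy_def)
  then obtain d where d: "\<And>i. d i \<in> P i" "\<And>i. r (Suc (k + i)) \<ominus> r (k + i) = c \<otimes> d i" by metis
  have dc: "d i \<in> carrier R" for i using d(1) P_carrier by blast
  define T where "T = rec_nat \<zero> (\<lambda>n t. t \<oplus> d n)"
  have T: "T 0 = \<zero>" "\<And>n. T (Suc n) = T n \<oplus> d n" by (simp_all add: T_def)
  have Tc: "T n \<in> carrier R" for n by (induction n) (simp_all add: T dc)
  have "T (Suc n) \<ominus> T n = d n" for n
    using Tc[of n] dc[of n] by (simp add: T add_diff_cancel)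
  then have cT: "cauchy T" using d(1) Tc by (simp add: cauchy_def)
  have "r (k + n) = r k \<oplus> c \<otimes> T n" for n
  proof (induction n)
    case 0 then show ?case using rc assms by (simp add: T)
  next
    case (Suc n)
    have "r (k + Suc n) = r (k + n) \<oplus> (r (Suc (k + n)) \<ominus> r (k + n))"
      using rc[of "k + n"] rc[of "Suc (k + n)"] by (simp add: add_diff_cancel)
    also have "\<dots> = r k \<oplus> c \<otimes> T n \<oplus> c \<otimes> d n" using Suc d(2)[of n] by (simp only:)
    also have "\<dots> = r k \<oplus> c \<otimes> T (Suc n)" using rc Tc dc assms by (simp add: T r_distr a_ac)
    finally show ?case .
  qed
  then have "s = adic_limit (\<lambda>n. r k \<oplus> c \<otimes> T n)"
    using adic_limit_shift(2)[OF r(1), of k] r(2) by simp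
  also have "\<dots> = \<phi> (r k) \<oplus>\<^bsub>S\<^esub> \<phi> c \<otimes>\<^bsub>S\<^esub> adic_limit T"
    using cT rc assms by (simp add: completion_simps)
  finally show thesis using that rc adic_limit_closed[OF cT] by blast
qed

text \<open>The k-th component alone decides: b and \<open>c \<otimes> r k\<close> differ by an
  element of \<open>P k\<close>, which is a multiple of c.\<close>

lemma completion_divides:
  assumes "b \<in> carrier R" "c \<in> carrier R" "c \<noteq> \<zero>" "t \<in> carrier S" "\<phi> b = \<phi> c \<otimes>\<^bsub>S\<^esub> t"
  obtains x where "x \<in> carrier R" "b = c \<otimes> x"
proof -
  obtain k where k: "P k \<subseteq> PIdl c" using conductor[OF assms(2,3)] by metis
  obtain r where r: "cauchy r" "t = adic_limit r" using assms(4) by (rule completion_rep)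
  have rc: "r k \<in> carrier R" using r(1) by (rule cauchy_carrier)
  have "adic_limit (\<lambda>_. b) = adic_limit (\<lambda>n. c \<otimes> r n)"
    using assms r by (simp add: completion_simps)
  then have "b \<ominus> c \<otimes> r k \<in> P k"
    using adic_limit_eq_iff[OF cauchy_const cauchy_mult[OF cauchy_const r(1)]] assms by blast
  then obtain y where y: "y \<in> carrier R" "b \<ominus> c \<otimes> r k = y \<otimes> c" using k by (auto simp: cgenideal_def)
  have "b = (b \<ominus> c \<otimes> r k) \<oplus> c \<otimes> r k" using assms rc by (simp add: add_diff_cancel)
  also have "\<dots> = c \<otimes> (y \<oplus> r k)" using y rc assms by (simp add: r_distr m_ac)
  finally show thesis using that y(1) rc by blast
qed

text \<open>If c times a sequence is null, cancelling c in the domain R puts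
  \<open>r (k + i)\<close> into \<open>P i\<close>, so the sequence shifted by k is null.\<close>

lemma completion_torsion_free:
  assumes "c \<in> carrier R" "c \<noteq> \<zero>" "t \<in> carrier S" "\<phi> c \<otimes>\<^bsub>S\<^esub> t = \<zero>\<^bsub>S\<^esub>"
  shows "t = \<zero>\<^bsub>S\<^esub>"
proof -
  obtain k where k: "\<And>i x. x \<in> P (k + i) \<Longrightarrow> \<exists>d\<in>P i. x = c \<otimes> d"
    using conductor[OF assms(1,2)] by metis
  obtain r where r: "cauchy r" "t = adic_limit r" using assms(3) by (rule completion_rep)
  have rc: "r n \<in> carrier R" for n using r(1) by (rule cauchy_carrier)
  have "adic_limit (\<lambda>n. c \<otimes> r n) = adic_limit (\<lambda>_. \<zero>)"
    using assms r by (simp add: completion_simps)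
  then have "c \<otimes> r n \<ominus> \<zero> \<in> P n" for n
    using adic_limit_eq_iff[OF cauchy_mult[OF cauchy_const r(1)] cauchy_const] assms by blast
  then have cr: "c \<otimes> r n \<in> P n" for n
    using rc assms by (simp add: a_minus_def)
  have "r (k + i) \<in> P i" for i
  proof -
    obtain d where d: "d \<in> P i" "c \<otimes> r (k + i) = c \<otimes> d" using k[OF cr[of "k + i"]] by blast
    then have "r (k + i) = d" using m_lcancel assms rc P_carrier by blast
    with d show ?thesis by simp
  qed
  then have "adic_limit (\<lambda>i. r (k + i)) = adic_limit (\<lambda>_. \<zero>)"
    using adic_limit_eq_iff[OF adic_limit_shift(1)[OF r(1)] cauchy_const] rc
    by (simp add: a_minus_def)
  then show ?thesis using adic_limit_shift(2)[OF r(1), of k] r(2) by (simp add: completion_simps)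
qed

section \<open>Convergence of a-adic series\<close>

lemma completion_nth:
  assumes "x \<in> carrier S"
  shows "x n \<in> carrier (R Quot P n)" "x (Suc n) \<subseteq> x n"
  using assms by (auto simp: adic_completion_def)

lemma completion_add_nth: "(x \<oplus>\<^bsub>S\<^esub> y) n = x n \<oplus>\<^bsub>R Quot P n\<^esub> y n"
  and completion_mult_nth: "(x \<otimes>\<^bsub>S\<^esub> y) n = x n \<otimes>\<^bsub>R Quot P n\<^esub> y n"
  by (simp_all add: adic_completion_def)

lemma power_mult_nth:
  assumes "a \<in> \<mm>" "y \<in> carrier S"
  shows "(\<phi> a [^]\<^bsub>S\<^esub> n \<otimes>\<^bsub>S\<^esub> y) n = \<zero>\<^bsub>R Quot P n\<^esub>"
proof -
  interpret Q: cring "R Quot P n" by (rule quotient_cring)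
  have a: "a \<in> carrier R" using assms(1) ideal.Icarr[OF max_ideal] by blast
  have pow: "\<phi> a [^]\<^bsub>S\<^esub> n = \<phi> (a [^] n)" using a by (induction n) simp_all
  have "\<phi> (a [^] n) n = \<zero>\<^bsub>R Quot P n\<^esub>"
    using a_rcos_zero[OF P_ideal pow_in_ideal_power[OF max_ideal assms(1)]]
    by (simp add: completion_map_def FactRing_def)
  then show ?thesis using completion_nth(1)[OF assms(2)] pow by (simp add: completion_mult_nth)
qed

text \<open>Unfolding the recurrence gives \<open>x 0 = p w\<^sub>n + a\<^sup>n x n\<close>, whose last term vanishes modulo
  \<open>\<mm>\<^sup>n\<close>, and the partial sums \<open>w\<^sub>n\<close> converge in \<open>S\<close>.\<close>

lemma completion_recurrence:
  assumes a: "a \<in> \<mm>" and p: "p \<in> carrier S"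
    and x: "\<And>t. x t \<in> carrier S" and w: "\<And>t. w t \<in> carrier S"
    and rec: "\<And>t. x t = p \<otimes>\<^bsub>S\<^esub> w t \<oplus>\<^bsub>S\<^esub> \<phi> a \<otimes>\<^bsub>S\<^esub> x (Suc t)"
  obtains v where "v \<in> carrier S" "x 0 = p \<otimes>\<^bsub>S\<^esub> v"
proof -
  have ac: "a \<in> carrier R" using a ideal.Icarr[OF max_ideal] by blast
  define \<alpha> where "\<alpha> = \<phi> a"
  have \<alpha>: "\<alpha> \<in> carrier S" using ac by (simp add: \<alpha>_def)
  define V where "V = rec_nat \<zero>\<^bsub>S\<^esub> (\<lambda>n v. v \<oplus>\<^bsub>S\<^esub> \<alpha> [^]\<^bsub>S\<^esub> n \<otimes>\<^bsub>S\<^esub> w n)"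
  have V: "V 0 = \<zero>\<^bsub>S\<^esub>" "\<And>n. V (Suc n) = V n \<oplus>\<^bsub>S\<^esub> \<alpha> [^]\<^bsub>S\<^esub> n \<otimes>\<^bsub>S\<^esub> w n"
    by (simp_all add: V_def)
  have Vc: "V n \<in> carrier S" for n by (induction n) (simp_all add: V \<alpha> w)
  have Veq: "V (Suc n) n = V n n" for n
  proof -
    interpret Q: cring "R Quot P n" by (rule quotient_cring)
    show ?thesis
      using power_mult_nth[OF a w, of n n] completion_nth(1)[OF Vc, of n n]
      by (simp add: V completion_add_nth \<alpha>_def)
  qed
  have sum: "x 0 = p \<otimes>\<^bsub>S\<^esub> V n \<oplus>\<^bsub>S\<^esub> \<alpha> [^]\<^bsub>S\<^esub> n \<otimes>\<^bsub>S\<^esub> x n" for n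
  proof (induction n)
    case 0 then show ?case using p x by (simp add: V)
  next
    case (Suc n)
    have "\<alpha> [^]\<^bsub>S\<^esub> n \<otimes>\<^bsub>S\<^esub> x n
        = p \<otimes>\<^bsub>S\<^esub> (\<alpha> [^]\<^bsub>S\<^esub> n \<otimes>\<^bsub>S\<^esub> w n) \<oplus>\<^bsub>S\<^esub> \<alpha> [^]\<^bsub>S\<^esub> Suc n \<otimes>\<^bsub>S\<^esub> x (Suc n)"
      using p w x \<alpha> by (subst rec) (simp add: S.r_distr S.m_ac \<alpha>_def[symmetric])
    then show ?case using p w x \<alpha> Vc by (subst Suc) (simp add: V S.r_distr S.a_ac)
  qed
  \<comment> \<open>The limit of the partial sums is their diagonal. It is a compatible sequence
    because passing from \<open>V n\<close> to \<open>V (Suc n)\<close> adds a term carrying the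
    n-th power of \<alpha>, which vanishes in component n.\<close>
  let ?v = "\<lambda>n. V n n"
  have v: "?v \<in> carrier S"
    using completion_nth[OF Vc] Veq by (auto simp: adic_completion_def) (metis subsetD)
  have "x 0 = p \<otimes>\<^bsub>S\<^esub> ?v"
  proof
    fix n
    interpret Q: cring "R Quot P n" by (rule quotient_cring)
    have "x 0 n = (p \<otimes>\<^bsub>S\<^esub> V n) n"
      using power_mult_nth[OF a x, of n n] completion_nth(1)[OF S.m_closed[OF p Vc], of n n]
      by (subst sum[of n]) (simp add: completion_add_nth \<alpha>_def)
    then show "x 0 n = (p \<otimes>\<^bsub>S\<^esub> ?v) n" by (simp add: completion_mult_nth)
  qed
  with v show thesis by (rule that)
qed

end

section \<open>Contents in the completion\<close>

context one_dim_local_domain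
begin

abbreviation completion_module (\<open>F\<close>) where "F \<equiv> restrict_scalars S \<phi>"

abbreviation extend_ideal :: "'a set \<Rightarrow> (nat \<Rightarrow> 'a set) set" where
  "extend_ideal I \<equiv> ideal_mult_module I F"

lemma module_simps [simp]:
  "carrier F = carrier S" "add F = add S" "ring.zero F = \<zero>\<^bsub>S\<^esub>" "smult F r s = \<phi> r \<otimes>\<^bsub>S\<^esub> s"
  by (simp_all add: restrict_scalars_def)

lemma obtain_nonzero_max:
  obtains a where "a \<in> \<mm>" "a \<in> carrier R" "a \<noteq> \<zero>"
proof -
  have "\<zero> \<in> \<mm>" using max_ideal by (simp add: additive_subgroup.zero_closed ideal.axioms(1))
  then show thesis using that max_nonzero ideal.Icarr[OF max_ideal] by blast
qed

lemma completion_one_not_zero: "\<one>\<^bsub>S\<^esub> \<noteq> \<zero>\<^bsub>S\<^esub>"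
proof
  assume one: "\<one>\<^bsub>S\<^esub> = \<zero>\<^bsub>S\<^esub>"
  obtain a where a: "a \<in> \<mm>" "a \<in> carrier R" "a \<noteq> \<zero>" by (rule obtain_nonzero_max)
  have "\<phi> \<one> = \<phi> a \<otimes>\<^bsub>S\<^esub> \<zero>\<^bsub>S\<^esub>" using one a by simp
  then obtain x where "x \<in> carrier R" "\<one> = a \<otimes> x"
    using completion_divides[of \<one> a "\<zero>\<^bsub>S\<^esub>"] a by auto
  then have "\<one> \<in> \<mm>" using ideal.I_r_closed[OF max_ideal a(1)] by simp
  then show False
    using ideal.one_imp_carrier[OF max_ideal] maximalideal.I_notcarr[OF max_maximal] by simp
qed

lemma to_completion_eq_zero_iff:
  assumes "r \<in> carrier R"
  shows "\<phi> r = \<zero>\<^bsub>S\<^esub> \<longleftrightarrow> r = \<zero>"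
  using completion_torsion_free[OF assms, of "\<one>\<^bsub>S\<^esub>"] completion_one_not_zero assms by auto

text \<open>The geometric series: the powers of -s satisfy the recurrence with p = 1 + as and with
  themselves as coefficients, so the zeroth power 1 is a multiple of p.\<close>

lemma one_plus_max_unit:
  assumes a: "a \<in> \<mm>" and s: "s \<in> carrier S"
  shows "\<one>\<^bsub>S\<^esub> \<oplus>\<^bsub>S\<^esub> \<phi> a \<otimes>\<^bsub>S\<^esub> s \<in> Units S"
proof -
  have ac: "\<phi> a \<in> carrier S" using a ideal.Icarr[OF max_ideal] by simp
  let ?p = "\<one>\<^bsub>S\<^esub> \<oplus>\<^bsub>S\<^esub> \<phi> a \<otimes>\<^bsub>S\<^esub> s" and ?x = "\<lambda>t::nat. (\<ominus>\<^bsub>S\<^esub> s) [^]\<^bsub>S\<^esub> t"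
  have "?x t = ?p \<otimes>\<^bsub>S\<^esub> ?x t \<oplus>\<^bsub>S\<^esub> \<phi> a \<otimes>\<^bsub>S\<^esub> ?x (Suc t)" for t
  proof -
    have "?x t \<in> carrier S" using s by simp
    then show ?thesis
      using s ac S.m_assoc[of "\<phi> a" s "?x t"] S.m_comm[of "?x t" s]
      by (simp add: S.l_distr S.r_minus S.a_assoc S.r_neg)
  qed
  then obtain v where v: "v \<in> carrier S" "?x 0 = ?p \<otimes>\<^bsub>S\<^esub> v"
    using completion_recurrence[OF a, of ?p ?x ?x] s ac by auto
  moreover have "?p \<in> carrier S" using s ac by simp
  ultimately show ?thesis using S.m_comm[of v ?p] by (auto simp: Units_def)
qed

lemma extend_ideal_generator:
  "i \<in> I \<Longrightarrow> s \<in> carrier S \<Longrightarrow> \<phi> i \<otimes>\<^bsub>S\<^esub> s \<in> extend_ideal I"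
  unfolding ideal_mult_module_def by (rule generate.incl) auto

lemma extend_ideal_add:
  "x \<in> extend_ideal I \<Longrightarrow> y \<in> extend_ideal I \<Longrightarrow> x \<oplus>\<^bsub>S\<^esub> y \<in> extend_ideal I"
  unfolding ideal_mult_module_def using generate.eng[of x "add_monoid F" _ y] by simp

text \<open>An additive property of generators need not be checked on inverses, as \<open>I\<close> is closed under
  negation.\<close>

lemma extend_ideal_induct [consumes 2, case_names zero generator add]:
  assumes "x \<in> extend_ideal I" "ideal I R"
    and zero: "Q \<zero>\<^bsub>S\<^esub>"
    and generator: "\<And>i s. i \<in> I \<Longrightarrow> s \<in> carrier S \<Longrightarrow> Q (\<phi> i \<otimes>\<^bsub>S\<^esub> s)"
    and add: "\<And>x y. \<lbrakk>x \<in> extend_ideal I; y \<in> extend_ideal I; Q x; Q y\<rbrakk> \<Longrightarrow> Q (x \<oplus>\<^bsub>S\<^esub> y)"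
  shows "Q x"
proof -
  let ?G = "{a \<odot>\<^bsub>F\<^esub> x | a x. a \<in> I \<and> x \<in> carrier F}"
  have "x \<in> generate (add_monoid F) ?G" using assms(1) by (simp add: ideal_mult_module_def)
  then show ?thesis
  proof (induction rule: generate.induct)
    case one then show ?case using zero by simp
  next
    case (incl h) then show ?case using generator by auto
  next
    case (inv h)
    then obtain i s where h: "h = \<phi> i \<otimes>\<^bsub>S\<^esub> s" "i \<in> I" "s \<in> carrier S" by auto
    then have ic: "i \<in> carrier R" using ideal.Icarr[OF assms(2)] by blast
    have "inv\<^bsub>add_monoid F\<^esub> h = \<ominus>\<^bsub>S\<^esub> h" by (simp add: a_inv_def m_inv_def)
    also have "\<dots> = \<phi> i \<otimes>\<^bsub>S\<^esub> (\<ominus>\<^bsub>S\<^esub> s)" using h ic by (simp add: S.r_minus)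
    finally show ?case using generator h by simp
  next
    case (eng x y)
    then show ?case using add by (simp add: ideal_mult_module_def)
  qed
qed

lemma extend_ideal_carrier:
  assumes "ideal I R" "x \<in> extend_ideal I"
  shows "x \<in> carrier S"
  using assms(2,1) by (induction rule: extend_ideal_induct) (auto dest: ideal.Icarr[OF assms(1)])

lemma extend_ideal_mult:
  assumes "ideal I R" "s \<in> carrier S" "x \<in> extend_ideal I"
  shows "x \<otimes>\<^bsub>S\<^esub> s \<in> extend_ideal I"
  using assms(3,1,2)
proof (induction rule: extend_ideal_induct)
  case zero
  then show ?case
    using extend_ideal_generator[of \<zero> I "\<zero>\<^bsub>S\<^esub>"] additive_subgroup.zero_closed[OF ideal.axioms(1)[OF assms(1)]]
    by simp
next
  case (generator i t)
  then have "\<phi> i \<otimes>\<^bsub>S\<^esub> t \<otimes>\<^bsub>S\<^esub> s = \<phi> i \<otimes>\<^bsub>S\<^esub> (t \<otimes>\<^bsub>S\<^esub> s)"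
    using ideal.Icarr[OF assms(1)] by (simp add: S.m_assoc)
  then show ?case using extend_ideal_generator[of i I "t \<otimes>\<^bsub>S\<^esub> s"] generator by simp
next
  case (add x y)
  then show ?case using extend_ideal_carrier[OF assms(1)] by (simp add: S.l_distr extend_ideal_add)
qed

text \<open>By density a coefficient s in a generator is is some r in R up to cS, and ir stays in I.
  An element of IS, a finite sum of generators, is thus a single element of I up to cS.\<close>

lemma extend_ideal_decompose:
  assumes "ideal I R" "c \<in> I" "c \<noteq> \<zero>" "x \<in> extend_ideal I"
  shows "\<exists>i\<in>I. \<exists>t\<in>carrier S. x = \<phi> i \<oplus>\<^bsub>S\<^esub> \<phi> c \<otimes>\<^bsub>S\<^esub> t"
proof -
  interpret I: ideal I R by fact
  have c: "c \<in> carrier R" using assms by auto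
  show ?thesis
    using assms(4,1)
  proof (induction rule: extend_ideal_induct)
    case zero
    show ?case using c by (intro bexI[of _ \<zero>] bexI[of _ "\<zero>\<^bsub>S\<^esub>"]) auto
  next
    case (generator i s)
    have i: "i \<in> carrier R" using generator by auto
    obtain r t where rt: "r \<in> carrier R" "t \<in> carrier S" "s = \<phi> r \<oplus>\<^bsub>S\<^esub> \<phi> c \<otimes>\<^bsub>S\<^esub> t"
      using completion_dense[OF c assms(3) generator(2)] .
    have "\<phi> i \<otimes>\<^bsub>S\<^esub> s = \<phi> (i \<otimes> r) \<oplus>\<^bsub>S\<^esub> \<phi> c \<otimes>\<^bsub>S\<^esub> (\<phi> i \<otimes>\<^bsub>S\<^esub> t)"
      using rt i c by (simp add: S.r_distr S.m_lcomm)
    then show ?case using rt i generator I.I_r_closed[of i r] by (metis S.m_closed \<phi>.hom_closed)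
  next
    case (add x y)
    then obtain i t j u where it: "i \<in> I" "t \<in> carrier S" "x = \<phi> i \<oplus>\<^bsub>S\<^esub> \<phi> c \<otimes>\<^bsub>S\<^esub> t"
      and ju: "j \<in> I" "u \<in> carrier S" "y = \<phi> j \<oplus>\<^bsub>S\<^esub> \<phi> c \<otimes>\<^bsub>S\<^esub> u" by blast
    have "x \<oplus>\<^bsub>S\<^esub> y = \<phi> (i \<oplus> j) \<oplus>\<^bsub>S\<^esub> \<phi> c \<otimes>\<^bsub>S\<^esub> (t \<oplus>\<^bsub>S\<^esub> u)"
      using it ju c I.Icarr by (simp add: S.r_distr S.a_ac)
    then show ?case using it ju by (meson I.a_closed S.a_closed)
  qed
qed

lemma extend_zero_ideal:
  assumes "x \<in> extend_ideal {\<zero>}"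
  shows "x = \<zero>\<^bsub>S\<^esub>"
  using assms zeroideal by (induction rule: extend_ideal_induct) auto

text \<open>Extension followed by contraction is the identity: decompose along some nonzero c in I;
  then r - i lies in both R and cS, hence in cR, hence in I. The zero ideal offers no such c and is
  handled by injectivity of \<phi>.\<close>

lemma extend_ideal_contract:
  assumes "ideal I R" "r \<in> carrier R" "\<phi> r \<in> extend_ideal I"
  shows "r \<in> I"
proof -
  interpret I: ideal I R by fact
  show ?thesis
  proof (cases "I = {\<zero>}")
    case True
    then show ?thesis using extend_zero_ideal[of "\<phi> r"] assms to_completion_eq_zero_iff by simp
  next
    case False
    then obtain c where c: "c \<in> I" "c \<noteq> \<zero>" using I.zero_closed by blast
    obtain i t where it: "i \<in> I" "t \<in> carrier S" "\<phi> r = \<phi> i \<oplus>\<^bsub>S\<^esub> \<phi> c \<otimes>\<^bsub>S\<^esub> t"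
      using extend_ideal_decompose[OF assms(1) c assms(3)] by blast
    have "\<phi> (r \<ominus> i) = \<phi> c \<otimes>\<^bsub>S\<^esub> t"
      using it assms c I.Icarr S.add_diff_cancel(1)[of "\<phi> i" "\<phi> c \<otimes>\<^bsub>S\<^esub> t"] by (simp add: a_minus_def)
    then obtain x where x: "x \<in> carrier R" "r \<ominus> i = c \<otimes> x"
      using completion_divides[of "r \<ominus> i" c t] it c assms I.Icarr by (metis minus_closed)
    then have "i \<oplus> (r \<ominus> i) \<in> I" using it c by (simp add: I.I_r_closed)
    then show ?thesis using it assms I.Icarr by (simp add: add_diff_cancel)
  qed
qed

lemma extend_ideal_principal:
  assumes "r \<in> carrier R" "s \<in> carrier S"
  shows "\<phi> r \<otimes>\<^bsub>S\<^esub> s \<in> extend_ideal (PIdl r)"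
  using extend_ideal_generator[of r "PIdl r" s] cgenideal_self assms by simp

text \<open>The family being intersected must be nonempty, since an empty intersection would be the
  whole type; the unit ideal belongs to it.\<close>

lemma content_ideal:
  assumes "f \<in> carrier S"
  shows "ideal (content R F f) R"
proof -
  have "f \<in> extend_ideal (carrier R)"
    using extend_ideal_generator[of \<one> "carrier R" f] assms by simp
  then have "carrier R \<in> {I. ideal I R \<and> f \<in> extend_ideal I}" using oneideal by blast
  then show ?thesis unfolding content_def by (intro i_Intersect) auto
qed

text \<open>An ideal whose extension contains \<open>\<phi> r \<otimes> u\<close> also has \<phi> r
  in its extension, as u is invertible, and contraction returns r itself. So (r) is the least ideal
  in the family.\<close>

lemma content_unit_multiple:
  assumes "r \<in> carrier R" "u \<in> Units S"
  shows "content R F (\<phi> r \<otimes>\<^bsub>S\<^esub> u) = PIdl r"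
proof
  have u: "u \<in> carrier S" using assms by auto
  show "content R F (\<phi> r \<otimes>\<^bsub>S\<^esub> u) \<subseteq> PIdl r"
    unfolding content_def
    using extend_ideal_principal[OF assms(1) u] cgenideal_ideal[OF assms(1)] by (intro Inter_lower) simp
  show "PIdl r \<subseteq> content R F (\<phi> r \<otimes>\<^bsub>S\<^esub> u)"
    unfolding content_def
  proof (intro Inter_greatest, clarify)
    fix I assume I: "ideal I R" "\<phi> r \<otimes>\<^bsub>S\<^esub> u \<in> extend_ideal I"
    have "\<phi> r \<otimes>\<^bsub>S\<^esub> u \<otimes>\<^bsub>S\<^esub> inv\<^bsub>S\<^esub> u \<in> extend_ideal I"
      using extend_ideal_mult[OF I(1) _ I(2)] assms by simp
    then have "\<phi> r \<in> extend_ideal I" using assms u by (simp add: S.m_assoc)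
    then have "r \<in> I" using extend_ideal_contract I assms by blast
    then have "PIdl r \<subseteq> I" using cgenideal_minimal[OF I(1)] by blast
    then show "\<And>x. x \<in> PIdl r \<Longrightarrow> x \<in> I" by blast
  qed
qed

section \<open>Elements of S that are units times elements of R\<close>

definition unit_multiples :: bool where
  "unit_multiples \<longleftrightarrow> (\<forall>f\<in>carrier S. f \<noteq> \<zero>\<^bsub>S\<^esub> \<longrightarrow>
     (\<exists>r\<in>carrier R. \<exists>u\<in>Units S. f = \<phi> r \<otimes>\<^bsub>S\<^esub> u))"

lemma unit_multiplesE:
  assumes unit_multiples "f \<in> carrier S"
  obtains r u where "r \<in> carrier R" "u \<in> Units S" "f = \<phi> r \<otimes>\<^bsub>S\<^esub> u"
proof (cases "f = \<zero>\<^bsub>S\<^esub>")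
  case True
  then show thesis using that[of \<zero> "\<one>\<^bsub>S\<^esub>"] by simp
qed (use assms that in \<open>auto simp: unit_multiples_def\<close>)

lemma ohm_rush_if_unit_multiples:
  assumes unit_multiples
  shows "ohm_rush R S \<phi>"
  unfolding ohm_rush_def
proof (intro conjI ballI)
  fix f assume "f \<in> carrier S"
  with assms obtain r u where "r \<in> carrier R" "u \<in> Units S" "f = \<phi> r \<otimes>\<^bsub>S\<^esub> u" by (rule unit_multiplesE)
  then show "f \<in> extend_ideal (content R F f)"
    using content_unit_multiple extend_ideal_principal by auto
qed (use is_cring completion_cring to_completion_hom in auto)

lemma ideal_prod_principal:
  assumes "r \<in> carrier R" "s \<in> carrier R"
  shows "(PIdl r) \<cdot> (PIdl s) = PIdl (r \<otimes> s)"
proof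
  show "PIdl (r \<otimes> s) \<subseteq> (PIdl r) \<cdot> (PIdl s)"
  proof (rule cgenideal_minimal)
    show "ideal ((PIdl r) \<cdot> (PIdl s)) R"
      using assms by (intro ideal_prod_is_ideal cgenideal_ideal)
    show "r \<otimes> s \<in> (PIdl r) \<cdot> (PIdl s)"
      using assms by (intro ideal_prod.prod cgenideal_self)
  qed
  have rs: "ideal (PIdl (r \<otimes> s)) R"
    using assms by (intro cgenideal_ideal m_closed)
  show "(PIdl r) \<cdot> (PIdl s) \<subseteq> PIdl (r \<otimes> s)"
  proof
    fix x assume "x \<in> (PIdl r) \<cdot> (PIdl s)"
    then show "x \<in> PIdl (r \<otimes> s)"
    proof (induction rule: ideal_prod.induct)
      case (prod i j)
      then obtain x y where xy: "i = x \<otimes> r" "j = y \<otimes> s" "x \<in> carrier R" "y \<in> carrier R"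
        by (auto simp: cgenideal_def)
      then have "i \<otimes> j = (x \<otimes> y) \<otimes> (r \<otimes> s)" using assms by (simp add: m_ac)
      then show ?case using xy by (auto simp: cgenideal_def)
    next
      case (sum x y)
      then show ?case using additive_subgroup.a_closed[OF ideal.axioms(1)[OF rs]] by blast
    qed
  qed
qed

lemma content_mult_if_unit_multiples:
  assumes unit_multiples "f \<in> carrier S" "g \<in> carrier S"
  shows "content R F (f \<otimes>\<^bsub>S\<^esub> g) = content R F f \<cdot> content R F g"
proof -
  obtain r u where ru: "r \<in> carrier R" "u \<in> Units S" "f = \<phi> r \<otimes>\<^bsub>S\<^esub> u"
    using assms(1,2) by (rule unit_multiplesE)
  obtain s v where sv: "s \<in> carrier R" "v \<in> Units S" "g = \<phi> s \<otimes>\<^bsub>S\<^esub> v"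
    using assms(1,3) by (rule unit_multiplesE)
  have "f \<otimes>\<^bsub>S\<^esub> g = \<phi> (r \<otimes> s) \<otimes>\<^bsub>S\<^esub> (u \<otimes>\<^bsub>S\<^esub> v)" using ru sv S.Units_closed by (simp add: S.m_ac)
  then have "content R F (f \<otimes>\<^bsub>S\<^esub> g) = PIdl (r \<otimes> s)"
    using content_unit_multiple[of "r \<otimes> s" "u \<otimes>\<^bsub>S\<^esub> v"] ru sv by (simp only: m_closed S.Units_m_closed)
  then show ?thesis using content_unit_multiple ideal_prod_principal ru sv by simp
qed

text \<open>Torsion-freeness makes a nonzero r regular on S, and unit factors do no harm.\<close>

lemma domain_if_unit_multiples:
  assumes unit_multiples
  shows "domain S"
proof (rule domainI[OF completion_cring completion_one_not_zero])
  fix f g assume fg: "f \<otimes>\<^bsub>S\<^esub> g = \<zero>\<^bsub>S\<^esub>" "f \<in> carrier S" "g \<in> carrier S"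
  obtain r u where ru: "r \<in> carrier R" "u \<in> Units S" "f = \<phi> r \<otimes>\<^bsub>S\<^esub> u"
    using assms fg(2) by (rule unit_multiplesE)
  show "f = \<zero>\<^bsub>S\<^esub> \<or> g = \<zero>\<^bsub>S\<^esub>"
  proof (cases "r = \<zero>")
    case False
    have "\<phi> r \<otimes>\<^bsub>S\<^esub> (u \<otimes>\<^bsub>S\<^esub> g) = \<zero>\<^bsub>S\<^esub>" using fg ru S.Units_closed by (simp add: S.m_assoc)
    then have ug: "u \<otimes>\<^bsub>S\<^esub> g = \<zero>\<^bsub>S\<^esub>"
      by (rule completion_torsion_free[rotated 3]) (use False ru fg in auto)
    have "g = inv\<^bsub>S\<^esub> u \<otimes>\<^bsub>S\<^esub> (u \<otimes>\<^bsub>S\<^esub> g)" using ru fg S.Units_closed by (simp flip: S.m_assoc)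
    then show ?thesis using ug ru by simp
  qed (use ru S.Units_closed in simp)
qed

lemma unit_multiples_if_ohm_rush:
  assumes "ohm_rush R S \<phi>"
  shows unit_multiples
  unfolding unit_multiples_def
proof (intro ballI impI)
  fix f assume f: "f \<in> carrier S" "f \<noteq> \<zero>\<^bsub>S\<^esub>"
  let ?I = "content R F f"
  have fI: "f \<in> extend_ideal ?I" using assms f by (simp add: ohm_rush_def)
  interpret I: ideal ?I R using f(1) by (rule content_ideal)
  have "?I \<noteq> {\<zero>}" using extend_zero_ideal fI f by auto
  then obtain c where c: "c \<in> ?I" "c \<noteq> \<zero>" using I.zero_closed by blast
  have cc: "c \<in> carrier R" using c by auto
  \<comment> \<open>The factor a prepares for Nakayama: decomposing along c alone would lead to the
    bound (r) + (c), which already contains c and says nothing about it.\<close>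
  obtain a where a: "a \<in> \<mm>" "a \<in> carrier R" "a \<noteq> \<zero>" by (rule obtain_nonzero_max)
  have ac: "a \<otimes> c \<in> ?I" "a \<otimes> c \<noteq> \<zero>" using a c cc I.I_l_closed integral by blast+
  obtain r s where rs: "r \<in> ?I" "s \<in> carrier S" "f = \<phi> r \<oplus>\<^bsub>S\<^esub> \<phi> (a \<otimes> c) \<otimes>\<^bsub>S\<^esub> s"
    using extend_ideal_decompose[OF I.is_ideal ac fI] by blast
  have r: "r \<in> carrier R" using rs by auto
  let ?J = "PIdl r <+>\<^bsub>R\<^esub> PIdl (a \<otimes> c)"
  note J = ideal_sum_principal[of "PIdl r" "a \<otimes> c", OF cgenideal_ideal[OF r] m_closed[OF a(2) cc]]
  have "r \<in> ?J" using J(2) cgenideal_self[OF r] by blast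
  then have "\<phi> r \<otimes>\<^bsub>S\<^esub> \<one>\<^bsub>S\<^esub> \<oplus>\<^bsub>S\<^esub> \<phi> (a \<otimes> c) \<otimes>\<^bsub>S\<^esub> s \<in> extend_ideal ?J"
    using J(3) rs(2) by (intro extend_ideal_add extend_ideal_generator) auto
  then have "f \<in> extend_ideal ?J" using rs(3) r by simp
  then have "?I \<subseteq> ?J" unfolding content_def using J(1) by (intro Inter_lower) simp
  then obtain x y where xy: "x \<in> carrier R" "y \<in> carrier R" "c = x \<otimes> r \<oplus> y \<otimes> (a \<otimes> c)"
    using c(1) unfolding set_add_def' cgenideal_def by blast
  have ay: "y \<otimes> a \<in> \<mm>" using a xy ideal.I_l_closed[OF max_ideal] by simp
  \<comment> \<open>Nakayama for the single element c: the equation reads (1 - ya)c = xr, and 1 - ya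
    is a unit because ya is in \<mm>.\<close>
  have "\<one> \<ominus> y \<otimes> a \<in> Units R"
  proof (rule unit_if_notin_max)
    show "\<one> \<ominus> y \<otimes> a \<notin> \<mm>"
    proof
      assume "\<one> \<ominus> y \<otimes> a \<in> \<mm>"
      then have "y \<otimes> a \<oplus> (\<one> \<ominus> y \<otimes> a) \<in> \<mm>"
        using ay max_ideal by (simp add: additive_subgroup.a_closed ideal.axioms(1))
      then have "\<one> \<in> \<mm>" using xy a by (simp add: add_diff_cancel)
      then show False
        using ideal.one_imp_carrier[OF max_ideal] maximalideal.I_notcarr[OF max_maximal] by simp
    qed
  qed (use xy a in simp)
  then obtain v where v: "v \<in> carrier R" "v \<otimes> (\<one> \<ominus> y \<otimes> a) = \<one>" by (auto simp: Units_def)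
  have "c \<ominus> y \<otimes> (a \<otimes> c) = x \<otimes> r"
    using xy r a cc add_diff_cancel(1)[of "y \<otimes> (a \<otimes> c)" "x \<otimes> r"]
      a_comm[of "x \<otimes> r" "y \<otimes> (a \<otimes> c)"] by simp
  moreover have "c \<ominus> y \<otimes> (a \<otimes> c) = (\<one> \<ominus> y \<otimes> a) \<otimes> c"
    using xy a cc by (simp add: a_minus_def l_distr l_minus m_assoc)
  ultimately have "v \<otimes> ((\<one> \<ominus> y \<otimes> a) \<otimes> c) = v \<otimes> (x \<otimes> r)" by simp
  moreover have "v \<otimes> ((\<one> \<ominus> y \<otimes> a) \<otimes> c) = c"
    using v xy a cc m_assoc[of v "\<one> \<ominus> y \<otimes> a" c] by simp
  moreover have "v \<otimes> (x \<otimes> r) = r \<otimes> (v \<otimes> x)" using v xy r by (simp add: m_ac)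
  ultimately have cz: "c = r \<otimes> (v \<otimes> x)" by simp
  define z where "z = v \<otimes> x"
  have z: "z \<in> carrier R" using v xy by (simp add: z_def)
  \<comment> \<open>With c = rz the correction acs equals r(azs), so r factors out and leaves an
    element of 1 + aS.\<close>
  have "f = \<phi> r \<otimes>\<^bsub>S\<^esub> (\<one>\<^bsub>S\<^esub> \<oplus>\<^bsub>S\<^esub> \<phi> a \<otimes>\<^bsub>S\<^esub> (\<phi> z \<otimes>\<^bsub>S\<^esub> s))"
    using rs(2,3) cz z r a by (simp add: z_def[symmetric] S.r_distr S.m_ac)
  then show "\<exists>r\<in>carrier R. \<exists>u\<in>Units S. f = \<phi> r \<otimes>\<^bsub>S\<^esub> u"
    using one_plus_max_unit[OF a(1), of "\<phi> z \<otimes>\<^bsub>S\<^esub> s"] z rs(2) r by auto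
qed

end

section \<open>Analytically irreducible implies Ohm-Rush\<close>

text \<open>The colon ideal (g) : a with membership in (g) spelled out; it will be taken over S for
  a power of \<alpha> and a power of f.\<close>

lemma (in cring) multiplier_ideal:
  assumes "a \<in> carrier R" "g \<in> carrier R"
  shows "ideal {x \<in> carrier R. \<exists>y\<in>carrier R. a \<otimes> x = g \<otimes> y} R"
proof -
  have "{x \<in> carrier R. \<exists>y\<in>carrier R. a \<otimes> x = g \<otimes> y} = {x \<in> carrier R. x \<otimes> a \<in> PIdl g}"
    using assms by (auto simp: cgenideal_def m_comm)
  then show ?thesis using ideal_quotient_ideal[OF cgenideal_ideal[OF assms(2)] assms(1)] by simp
qed

context one_dim_local_domain
begin

text \<open>Let \<open>\<alpha>\<close> be the image of \<open>a \<in> \<mm>\<close>, nonzero. The ideals of those \<open>x\<close> with \<open>\<alpha>\<^sup>j x \<in> f\<^sup>n S\<close>, taken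
  modulo \<open>\<alpha>\<close>, are determined by ideals of \<open>R\<close> containing \<open>a\<close>, so they stabilise in both \<open>j\<close> and
  \<open>n\<close>. Then \<open>f\<^sup>n\<close> can be expanded in powers of \<open>\<alpha>\<close> with coefficients \<open>y\<close> for which
  \<open>\<alpha>\<^sup>j y \<in> f\<^sup>n\<^sup>+\<^sup>1 S\<close> with \<open>j\<close> fixed, whence \<open>\<alpha>\<^sup>j f\<^sup>n \<in> f\<^sup>n\<^sup>+\<^sup>1 S\<close>.\<close>

lemma power_divisible:
  assumes dom: "domain S" and f: "f \<in> carrier S" "f \<noteq> \<zero>\<^bsub>S\<^esub>"
    and a: "a \<in> \<mm>" "a \<noteq> \<zero>"
  shows "\<exists>j w. w \<in> carrier S \<and> \<phi> (a [^] (j :: nat)) = f \<otimes>\<^bsub>S\<^esub> w"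
proof -
  interpret D: domain S by fact
  have ac: "a \<in> carrier R" using a ideal.Icarr[OF max_ideal] by blast
  define \<alpha> where "\<alpha> = \<phi> a"
  have \<alpha>: "\<alpha> \<in> carrier S" using ac by (simp add: \<alpha>_def)
  have pow: "\<alpha> [^]\<^bsub>S\<^esub> n = \<phi> (a [^] n)" for n :: nat
    unfolding \<alpha>_def using ac by (induction n) simp_all
  define L where "L n j = {x \<in> carrier S. \<exists>y\<in>carrier S. \<alpha> [^]\<^bsub>S\<^esub> j \<otimes>\<^bsub>S\<^esub> x = f [^]\<^bsub>S\<^esub> n \<otimes>\<^bsub>S\<^esub> y}"
    for n j :: nat
  have Lid: "ideal (L n j) S" for n j
    unfolding L_def using \<alpha> f by (intro S.multiplier_ideal) simp_all
  \<comment> \<open>S/\<alpha>S is a quotient of R by density, so the preimage \<open>K n j\<close>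
    retains all of \<open>L n j\<close> modulo \<alpha> and lies where chain conditions are
    available.\<close>
  define K where "K n j = {r \<in> carrier R. \<phi> r \<in> L n j <+>\<^bsub>S\<^esub> PIdl\<^bsub>S\<^esub> \<alpha>}" for n j
  have Kid: "ideal (K n j) R" for n j
    unfolding K_def by (intro \<phi>.ring.ideal_vimage S.ideal_sum_principal(1) Lid \<alpha>)
  have Lj: "L n j \<subseteq> L n (Suc j)" for n j
  proof
    fix x assume "x \<in> L n j"
    then obtain y where x: "x \<in> carrier S" and y: "y \<in> carrier S" "\<alpha> [^]\<^bsub>S\<^esub> j \<otimes>\<^bsub>S\<^esub> x = f [^]\<^bsub>S\<^esub> n \<otimes>\<^bsub>S\<^esub> y"
      unfolding L_def by blast
    have "\<alpha> [^]\<^bsub>S\<^esub> Suc j \<otimes>\<^bsub>S\<^esub> x = \<alpha> \<otimes>\<^bsub>S\<^esub> (\<alpha> [^]\<^bsub>S\<^esub> j \<otimes>\<^bsub>S\<^esub> x)" using x \<alpha> by (simp add: S.m_ac)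
    also have "\<dots> = f [^]\<^bsub>S\<^esub> n \<otimes>\<^bsub>S\<^esub> (\<alpha> \<otimes>\<^bsub>S\<^esub> y)" unfolding y(2) using y(1) f \<alpha> by (simp add: S.m_lcomm)
    finally show "x \<in> L n (Suc j)" unfolding L_def using x y \<alpha> by blast
  qed
  have Ln: "L (Suc n) j \<subseteq> L n j" for n j
  proof
    fix x assume "x \<in> L (Suc n) j"
    then obtain y where x: "x \<in> carrier S" and y: "y \<in> carrier S" "\<alpha> [^]\<^bsub>S\<^esub> j \<otimes>\<^bsub>S\<^esub> x = f [^]\<^bsub>S\<^esub> Suc n \<otimes>\<^bsub>S\<^esub> y"
      unfolding L_def by blast
    have "\<alpha> [^]\<^bsub>S\<^esub> j \<otimes>\<^bsub>S\<^esub> x = f [^]\<^bsub>S\<^esub> n \<otimes>\<^bsub>S\<^esub> (f \<otimes>\<^bsub>S\<^esub> y)" using y f by (simp add: S.m_assoc)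
    then show "x \<in> L n j" unfolding L_def using x y f by blast
  qed
  have Kj: "K n j \<subseteq> K n (Suc j)" and Kn: "K (Suc n) j \<subseteq> K n j" for n j
    using Lj[of n j] Ln[of n j] unfolding K_def set_add_def' by blast+
  \<comment> \<open>For fixed n the ideals grow with j, so the ascending condition applies and gives
    an exponent \<open>m n\<close>, which may vary with n. The unions \<open>J n\<close> then shrink
    with n and contain a, so the descending condition applies to them.\<close>
  have "\<exists>m. \<Union>(range (K n)) = K n m" for n
  proof -
    have "K n i \<subseteq> K n j" if "i \<le> j" for i j using lift_Suc_mono_le[of "K n", OF Kj that] .
    then have "K n i \<subseteq> K n j \<or> K n j \<subseteq> K n i" for i j by (metis linear)
    then have "subset.chain {I. ideal I R} (range (K n))"
      unfolding pred_on.chain_def using Kid by blast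
    then have "\<Union>(range (K n)) \<in> range (K n)" by (intro ideal_chain_is_trivial) auto
    then show ?thesis by auto
  qed
  then obtain m where m: "\<And>n. \<Union>(range (K n)) = K n (m n)" by metis
  define J where "J n = K n (m n)" for n
  have J: "r \<in> J n \<longleftrightarrow> (\<exists>j. r \<in> K n j)" for r n unfolding J_def using m[of n] by blast
  have aJ: "PIdl a \<subseteq> J n" for n
  proof (rule cgenideal_minimal)
    show "ideal (J n) R" unfolding J_def by (rule Kid)
    have "\<phi> a \<in> L n 0 <+>\<^bsub>S\<^esub> PIdl\<^bsub>S\<^esub> \<alpha>"
      using S.ideal_sum_principal(3)[OF Lid \<alpha>] by (simp add: \<alpha>_def)
    then show "a \<in> J n" unfolding J using ac by (auto simp: K_def)
  qed
  have "PIdl a \<noteq> {\<zero>}" using cgenideal_self[OF ac] a by blast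
  moreover have "J (Suc n) \<subseteq> J n" for n using Kn[of n] J by blast
  ultimately obtain N where N: "\<forall>n\<ge>N. J n = J N"
    using descending_chain_stabilises[of "PIdl a" J] cgenideal_ideal[OF ac] aJ Kid
    unfolding J_def by blast
  \<comment> \<open>The exponent belongs to level \<open>Suc N\<close>: stability moves residues
    from \<open>J N\<close> to \<open>J (Suc N)\<close>, and there this one power of \<alpha> serves
    all of them.\<close>
  define j where "j = m (Suc N)"
  \<comment> \<open>The saturation of the ideal generated by the N-th power of f with respect to
    \<alpha>. Each expansion step divides by \<alpha> and may raise the exponent needed, so the
    union over all exponents is what is stable under iteration.\<close>
  define U where "U = (\<Union>j. L N j)"
  have step: "\<exists>x'\<in>U. \<exists>w\<in>carrier S. \<alpha> [^]\<^bsub>S\<^esub> j \<otimes>\<^bsub>S\<^esub> x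
      = f [^]\<^bsub>S\<^esub> Suc N \<otimes>\<^bsub>S\<^esub> w \<oplus>\<^bsub>S\<^esub> \<alpha> \<otimes>\<^bsub>S\<^esub> (\<alpha> [^]\<^bsub>S\<^esub> j \<otimes>\<^bsub>S\<^esub> x')" if "x \<in> U" for x
  proof -
    obtain i where i: "x \<in> L N i" using \<open>x \<in> U\<close> by (auto simp: U_def)
    then have x: "x \<in> carrier S" by (simp add: L_def)
    obtain r t where rt: "r \<in> carrier R" "t \<in> carrier S" "x = \<phi> r \<oplus>\<^bsub>S\<^esub> \<alpha> \<otimes>\<^bsub>S\<^esub> t"
      using completion_dense[OF ac a(2) x] unfolding \<alpha>_def .
    have "\<phi> r = x \<oplus>\<^bsub>S\<^esub> (\<ominus>\<^bsub>S\<^esub> t) \<otimes>\<^bsub>S\<^esub> \<alpha>"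
      using rt \<alpha> by (simp add: S.a_assoc S.m_comm[of \<alpha>] S.l_minus S.r_neg)
    then have "r \<in> K N i" unfolding K_def set_add_def' cgenideal_def using i rt by blast
    then have "r \<in> J (Suc N)" using N J by (metis le_Suc_eq order_refl)
    then obtain y s where y: "y \<in> L (Suc N) j" and s: "s \<in> carrier S" "\<phi> r = y \<oplus>\<^bsub>S\<^esub> s \<otimes>\<^bsub>S\<^esub> \<alpha>"
      unfolding J_def j_def K_def set_add_def' cgenideal_def by blast
    obtain w where yc: "y \<in> carrier S" and w: "w \<in> carrier S" "\<alpha> [^]\<^bsub>S\<^esub> j \<otimes>\<^bsub>S\<^esub> y = f [^]\<^bsub>S\<^esub> Suc N \<otimes>\<^bsub>S\<^esub> w"
      using y unfolding L_def by blast
    let ?x = "s \<oplus>\<^bsub>S\<^esub> t"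
    have xc: "?x \<in> carrier S" using s rt by simp
    have xeq: "x = y \<oplus>\<^bsub>S\<^esub> \<alpha> \<otimes>\<^bsub>S\<^esub> ?x"
      using rt(2,3) s yc \<alpha> by (simp add: S.a_assoc S.r_distr S.m_comm)
    \<comment> \<open>Both x and y lie in \<open>L N ?k\<close>, hence so does their difference,
      which is \<alpha> times \<open>?x\<close>; one more power of \<alpha> absorbs this
      factor.\<close>
    have "?x \<in> U"
    proof -
      let ?k = "max i j"
      have mono: "L N p \<subseteq> L N q" if "p \<le> q" for p q using lift_Suc_mono_le[of "L N", OF Lj that] .
      have xk: "x \<in> L N ?k" and yk: "y \<in> L N ?k"
        using mono[of i ?k] mono[of j ?k] i y Ln[of N j] by auto
      interpret k: ideal "L N ?k" S by (rule Lid)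
      have "x \<ominus>\<^bsub>S\<^esub> y \<in> L N ?k" using xk yk by (simp add: a_minus_def)
      moreover have "x \<ominus>\<^bsub>S\<^esub> y = \<alpha> \<otimes>\<^bsub>S\<^esub> ?x"
        using xeq S.add_diff_cancel(1)[of y "\<alpha> \<otimes>\<^bsub>S\<^esub> ?x"] yc xc \<alpha> by simp
      ultimately obtain v where "v \<in> carrier S" "\<alpha> [^]\<^bsub>S\<^esub> ?k \<otimes>\<^bsub>S\<^esub> (\<alpha> \<otimes>\<^bsub>S\<^esub> ?x) = f [^]\<^bsub>S\<^esub> N \<otimes>\<^bsub>S\<^esub> v"
        unfolding L_def by auto
      then have "?x \<in> L N (Suc ?k)" unfolding L_def using xc \<alpha> by (auto simp: S.m_assoc)
      then show ?thesis unfolding U_def by blast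
    qed
    moreover have "\<alpha> [^]\<^bsub>S\<^esub> j \<otimes>\<^bsub>S\<^esub> x = f [^]\<^bsub>S\<^esub> Suc N \<otimes>\<^bsub>S\<^esub> w \<oplus>\<^bsub>S\<^esub> \<alpha> \<otimes>\<^bsub>S\<^esub> (\<alpha> [^]\<^bsub>S\<^esub> j \<otimes>\<^bsub>S\<^esub> ?x)"
    proof -
      have "\<alpha> [^]\<^bsub>S\<^esub> j \<otimes>\<^bsub>S\<^esub> x = \<alpha> [^]\<^bsub>S\<^esub> j \<otimes>\<^bsub>S\<^esub> y \<oplus>\<^bsub>S\<^esub> \<alpha> [^]\<^bsub>S\<^esub> j \<otimes>\<^bsub>S\<^esub> (\<alpha> \<otimes>\<^bsub>S\<^esub> ?x)"
        unfolding arg_cong[OF xeq, of "\<lambda>z. \<alpha> [^]\<^bsub>S\<^esub> j \<otimes>\<^bsub>S\<^esub> z"] by (rule S.r_distr) (use yc xc \<alpha> in auto)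
      also have "\<alpha> [^]\<^bsub>S\<^esub> j \<otimes>\<^bsub>S\<^esub> (\<alpha> \<otimes>\<^bsub>S\<^esub> ?x) = \<alpha> \<otimes>\<^bsub>S\<^esub> (\<alpha> [^]\<^bsub>S\<^esub> j \<otimes>\<^bsub>S\<^esub> ?x)"
        by (rule S.m_lcomm) (use xc \<alpha> in auto)
      finally show ?thesis unfolding w(2) .
    qed
    ultimately show ?thesis using w(1) by blast
  qed
  then obtain nxt cf where nxt: "\<And>x. x \<in> U \<Longrightarrow> nxt x \<in> U" "\<And>x. x \<in> U \<Longrightarrow> cf x \<in> carrier S"
    "\<And>x. x \<in> U \<Longrightarrow> \<alpha> [^]\<^bsub>S\<^esub> j \<otimes>\<^bsub>S\<^esub> x
      = f [^]\<^bsub>S\<^esub> Suc N \<otimes>\<^bsub>S\<^esub> cf x \<oplus>\<^bsub>S\<^esub> \<alpha> \<otimes>\<^bsub>S\<^esub> (\<alpha> [^]\<^bsub>S\<^esub> j \<otimes>\<^bsub>S\<^esub> nxt x)" by metis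
  define x where "x t = (nxt ^^ t) (f [^]\<^bsub>S\<^esub> N)" for t
  have x0: "x 0 = f [^]\<^bsub>S\<^esub> N" and xS: "x (Suc t) = nxt (x t)" for t by (simp_all add: x_def)
  have "f [^]\<^bsub>S\<^esub> N \<in> L N 0" unfolding L_def using f by (auto intro!: bexI[of _ "\<one>\<^bsub>S\<^esub>"])
  then have "x 0 \<in> U" unfolding U_def x0 by blast
  then have xU: "x t \<in> U" for t by (induction t) (simp_all add: xS nxt(1))
  have Uc: "y \<in> carrier S" if "y \<in> U" for y using that by (auto simp: U_def L_def)
  obtain v where v: "v \<in> carrier S" "\<alpha> [^]\<^bsub>S\<^esub> j \<otimes>\<^bsub>S\<^esub> x 0 = f [^]\<^bsub>S\<^esub> Suc N \<otimes>\<^bsub>S\<^esub> v"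
  proof (rule completion_recurrence[of a "f [^]\<^bsub>S\<^esub> Suc N" "\<lambda>t. \<alpha> [^]\<^bsub>S\<^esub> j \<otimes>\<^bsub>S\<^esub> x t" "\<lambda>t. cf (x t)"])
    show "f [^]\<^bsub>S\<^esub> Suc N \<in> carrier S" using f(1) by (rule S.nat_pow_closed)
    show "\<alpha> [^]\<^bsub>S\<^esub> j \<otimes>\<^bsub>S\<^esub> x t = f [^]\<^bsub>S\<^esub> Suc N \<otimes>\<^bsub>S\<^esub> cf (x t) \<oplus>\<^bsub>S\<^esub> \<phi> a \<otimes>\<^bsub>S\<^esub> (\<alpha> [^]\<^bsub>S\<^esub> j \<otimes>\<^bsub>S\<^esub> x (Suc t))" for t
      using nxt(3)[OF xU[of t]] unfolding xS \<alpha>_def .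
  qed (use a \<alpha> nxt(2) xU Uc in auto)
  have "f [^]\<^bsub>S\<^esub> N \<otimes>\<^bsub>S\<^esub> \<alpha> [^]\<^bsub>S\<^esub> j = f [^]\<^bsub>S\<^esub> N \<otimes>\<^bsub>S\<^esub> (f \<otimes>\<^bsub>S\<^esub> v)"
    using v f \<alpha> by (simp add: x0 S.m_ac)
  \<comment> \<open>Integrality of S enters: the N-th power of f is nonzero and cancels, leaving f
    times v.\<close>
  moreover have "f [^]\<^bsub>S\<^esub> N \<noteq> \<zero>\<^bsub>S\<^esub>"
    using f by (induction N) (auto simp: D.integral_iff)
  ultimately have "\<alpha> [^]\<^bsub>S\<^esub> j = f \<otimes>\<^bsub>S\<^esub> v"
    using D.m_lcancel f \<alpha> v(1) by simp
  then show ?thesis using v(1) pow by metis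
qed

lemma unit_multiples_if_domain:
  assumes "domain S"
  shows unit_multiples
  unfolding unit_multiples_def
proof (intro ballI impI)
  fix f assume f: "f \<in> carrier S" "f \<noteq> \<zero>\<^bsub>S\<^esub>"
  obtain a where a: "a \<in> \<mm>" "a \<in> carrier R" "a \<noteq> \<zero>" by (rule obtain_nonzero_max)
  obtain j :: nat and w where w: "w \<in> carrier S" "\<phi> (a [^] j) = f \<otimes>\<^bsub>S\<^esub> w"
    using power_divisible[OF assms f a(1,3)] by blast
  \<comment> \<open>One power more than f is known to divide: the correction
    \<open>\<phi> ?c \<otimes> s\<close> is then f times a multiple of a, so moving it to the left
    multiplies f by an element of 1 + aS.\<close>
  let ?c = "a [^] Suc j"
  have c: "?c \<in> carrier R" "?c \<noteq> \<zero>" proof -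
    have "a [^] n \<noteq> \<zero>" for n :: nat using a by (induction n) (auto simp: integral_iff)
    then show "?c \<noteq> \<zero>" .
  qed (use a in simp)
  obtain r s where rs: "r \<in> carrier R" "s \<in> carrier S" "f = \<phi> r \<oplus>\<^bsub>S\<^esub> \<phi> ?c \<otimes>\<^bsub>S\<^esub> s"
    using completion_dense[OF c f(1)] .
  let ?z = "\<ominus>\<^bsub>S\<^esub> (w \<otimes>\<^bsub>S\<^esub> s)"
  let ?u = "\<one>\<^bsub>S\<^esub> \<oplus>\<^bsub>S\<^esub> \<phi> a \<otimes>\<^bsub>S\<^esub> ?z"
  have z: "?z \<in> carrier S" using w rs by simp
  have u: "?u \<in> Units S" using one_plus_max_unit[OF a(1) z] .
  have "\<phi> ?c \<otimes>\<^bsub>S\<^esub> s = f \<otimes>\<^bsub>S\<^esub> (\<phi> a \<otimes>\<^bsub>S\<^esub> (w \<otimes>\<^bsub>S\<^esub> s))"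
    using w a f(1) rs(2) by (simp add: S.m_ac)
  then have f2: "f = \<phi> r \<oplus>\<^bsub>S\<^esub> f \<otimes>\<^bsub>S\<^esub> (\<phi> a \<otimes>\<^bsub>S\<^esub> (w \<otimes>\<^bsub>S\<^esub> s))" using rs(3) by simp
  have "f \<otimes>\<^bsub>S\<^esub> ?u = f \<ominus>\<^bsub>S\<^esub> f \<otimes>\<^bsub>S\<^esub> (\<phi> a \<otimes>\<^bsub>S\<^esub> (w \<otimes>\<^bsub>S\<^esub> s))"
    using f(1) w(1) rs(2) a(2) by (simp add: S.r_distr S.r_minus a_minus_def)
  also have "\<dots> = \<phi> r"
    using f2 S.add_diff_cancel(1)[of "f \<otimes>\<^bsub>S\<^esub> (\<phi> a \<otimes>\<^bsub>S\<^esub> (w \<otimes>\<^bsub>S\<^esub> s))" "\<phi> r"] f(1) w(1) rs(1,2) a(2)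
    by (metis S.a_comm S.m_closed \<phi>.hom_closed)
  finally have fu: "f \<otimes>\<^bsub>S\<^esub> ?u = \<phi> r" .
  have "f = f \<otimes>\<^bsub>S\<^esub> ?u \<otimes>\<^bsub>S\<^esub> inv\<^bsub>S\<^esub> ?u"
    using u f(1) S.m_assoc[of f ?u "inv\<^bsub>S\<^esub> ?u"] S.Units_closed[OF u] S.Units_inv_closed[OF u] S.Units_r_inv[OF u]
    by (simp only: S.r_one)
  then have "f = \<phi> r \<otimes>\<^bsub>S\<^esub> inv\<^bsub>S\<^esub> ?u" unfolding fu .
  then show "\<exists>r\<in>carrier R. \<exists>u\<in>Units S. f = \<phi> r \<otimes>\<^bsub>S\<^esub> u" using rs(1) S.Units_inv_Units[OF u] by blast
qed

end

section \<open>Faithful flatness from local coordinates\<close>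

locale module_pair = M: module R M + F: module R F
  for R :: "('a, 'r) ring_scheme" and M :: "('a, 'b, 'p) module_scheme" and F :: "('a, 'f, 's) module_scheme"
begin

abbreviation free (\<open>\<F>\<close>) where "\<F> \<equiv> free_Abelian_group (carrier M \<times> carrier F)"

abbreviation rel (\<open>\<R>\<close>) where "\<R> \<equiv> tensor_relations R M F"

definition rel_generators :: "('b \<times> 'f \<Rightarrow>\<^sub>0 int) set" where
  "rel_generators =
    {frag_of (x \<oplus>\<^bsub>M\<^esub> x', y) - frag_of (x, y) - frag_of (x', y) | x x' y.
       x \<in> carrier M \<and> x' \<in> carrier M \<and> y \<in> carrier F} \<union>
    {frag_of (x, y \<oplus>\<^bsub>F\<^esub> y') - frag_of (x, y) - frag_of (x, y') | x y y'.
       x \<in> carrier M \<and> y \<in> carrier F \<and> y' \<in> carrier F} \<union>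
    {frag_of (r \<odot>\<^bsub>M\<^esub> x, y) - frag_of (x, r \<odot>\<^bsub>F\<^esub> y) | r x y.
       r \<in> carrier R \<and> x \<in> carrier M \<and> y \<in> carrier F}"

lemma rel_eq: "\<R> = generate \<F> rel_generators"
  unfolding tensor_relations_def rel_generators_def ..

lemma rel_generators_closed: "rel_generators \<subseteq> carrier \<F>"
  unfolding rel_generators_def by (auto dest!: subsetD[OF keys_diff])

lemma rel_subgroup: "subgroup \<R> \<F>"
  unfolding rel_eq by (rule group.generate_is_subgroup[OF group_free_Abelian_group rel_generators_closed])

lemma rel_keys: "u \<in> \<R> \<Longrightarrow> Poly_Mapping.keys u \<subseteq> carrier M \<times> carrier F"
  using subgroup.mem_carrier[OF rel_subgroup, of u] by simp

lemma rel_zero: "0 \<in> \<R>"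
  using subgroup.one_closed[OF rel_subgroup] by simp

lemma rel_add: "u \<in> \<R> \<Longrightarrow> v \<in> \<R> \<Longrightarrow> u + v \<in> \<R>"
  using subgroup.m_closed[OF rel_subgroup] by simp

lemma rel_uminus: "u \<in> \<R> \<Longrightarrow> - u \<in> \<R>"
  using subgroup.m_inv_closed[OF rel_subgroup] rel_keys by fastforce

lemma rel_diff: "u \<in> \<R> \<Longrightarrow> v \<in> \<R> \<Longrightarrow> u - v \<in> \<R>"
  using rel_add[of u "- v"] rel_uminus by simp

lemma rel_sum: "(\<And>i. i \<in> I \<Longrightarrow> u i \<in> \<R>) \<Longrightarrow> sum u I \<in> \<R>"
  by (induction I rule: infinite_finite_induct) (auto intro: rel_zero rel_add)

lemma rel_left:
  "x \<in> carrier M \<Longrightarrow> x' \<in> carrier M \<Longrightarrow> y \<in> carrier F \<Longrightarrow>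
    frag_of (x \<oplus>\<^bsub>M\<^esub> x', y) - frag_of (x, y) - frag_of (x', y) \<in> \<R>"
  unfolding rel_eq by (intro generate.incl) (auto simp: rel_generators_def)

lemma rel_right:
  "x \<in> carrier M \<Longrightarrow> y \<in> carrier F \<Longrightarrow> y' \<in> carrier F \<Longrightarrow>
    frag_of (x, y \<oplus>\<^bsub>F\<^esub> y') - frag_of (x, y) - frag_of (x, y') \<in> \<R>"
  unfolding rel_eq by (intro generate.incl) (auto simp: rel_generators_def)

lemma rel_scalar:
  "r \<in> carrier R \<Longrightarrow> x \<in> carrier M \<Longrightarrow> y \<in> carrier F \<Longrightarrow>
    frag_of (r \<odot>\<^bsub>M\<^esub> x, y) - frag_of (x, r \<odot>\<^bsub>F\<^esub> y) \<in> \<R>"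
  unfolding rel_eq by (intro generate.incl) (auto simp: rel_generators_def)

lemma rel_induct [consumes 1, case_names zero left right scalar diff]:
  assumes u: "u \<in> \<R>" and zero: "Q 0"
    and left: "\<And>x x' y. \<lbrakk>x \<in> carrier M; x' \<in> carrier M; y \<in> carrier F\<rbrakk> \<Longrightarrow>
      Q (frag_of (x \<oplus>\<^bsub>M\<^esub> x', y) - frag_of (x, y) - frag_of (x', y))"
    and right: "\<And>x y y'. \<lbrakk>x \<in> carrier M; y \<in> carrier F; y' \<in> carrier F\<rbrakk> \<Longrightarrow>
      Q (frag_of (x, y \<oplus>\<^bsub>F\<^esub> y') - frag_of (x, y) - frag_of (x, y'))"
    and scalar: "\<And>r x y. \<lbrakk>r \<in> carrier R; x \<in> carrier M; y \<in> carrier F\<rbrakk> \<Longrightarrow>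
      Q (frag_of (r \<odot>\<^bsub>M\<^esub> x, y) - frag_of (x, r \<odot>\<^bsub>F\<^esub> y))"
    and diff: "\<And>u v. \<lbrakk>u \<in> \<R>; v \<in> \<R>; Q u; Q v\<rbrakk> \<Longrightarrow> Q (u - v)"
  shows "Q u"
proof -
  have minus: "Q (- u)" if "u \<in> \<R>" "Q u" for u
    using diff[OF rel_zero \<open>u \<in> \<R>\<close> zero \<open>Q u\<close>] by simp
  have gen: "Q h" if "h \<in> rel_generators" for h
    using that left right scalar unfolding rel_generators_def by auto
  have "u \<in> \<R> \<and> Q u"
    using u[unfolded rel_eq]
  proof (induction rule: generate.induct)
    case one
    then show ?case using zero rel_zero by simp
  next
    case (incl h)
    then show ?case using gen by (simp add: rel_eq generate.incl)
  next
    case (inv h)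
    then have h: "h \<in> \<R>" "Q h" using gen by (simp_all add: rel_eq generate.incl)
    then have "inv\<^bsub>\<F>\<^esub> h = - h" using rel_keys by simp
    then show ?case using minus[OF h] rel_uminus[OF h(1)] by simp
  next
    case (eng u v)
    then have "Q (u - - v)" using diff[of u "- v"] rel_uminus minus by blast
    then show ?case using eng rel_add by simp
  qed
  then show ?thesis ..
qed

lemma rel_zero_left:
  assumes "y \<in> carrier F"
  shows "frag_of (\<zero>\<^bsub>M\<^esub>, y) \<in> \<R>"
  using rel_uminus[OF rel_left[of "\<zero>\<^bsub>M\<^esub>" "\<zero>\<^bsub>M\<^esub>" y]] assms by simp

lemma rel_zero_right:
  assumes "x \<in> carrier M"
  shows "frag_of (x, \<zero>\<^bsub>F\<^esub>) \<in> \<R>"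
  using rel_uminus[OF rel_right[of x "\<zero>\<^bsub>F\<^esub>" "\<zero>\<^bsub>F\<^esub>"]] assms by simp

lemma rel_diff_left:
  assumes "x \<in> carrier M" "x' \<in> carrier M" "y \<in> carrier F"
  shows "frag_of (x \<ominus>\<^bsub>M\<^esub> x', y) - (frag_of (x, y) - frag_of (x', y)) \<in> \<R>"
proof -
  have "x = (x \<ominus>\<^bsub>M\<^esub> x') \<oplus>\<^bsub>M\<^esub> x'" using assms by (simp add: a_minus_def M.a_assoc M.l_neg)
  then have "frag_of (x, y) - frag_of (x \<ominus>\<^bsub>M\<^esub> x', y) - frag_of (x', y) \<in> \<R>"
    using rel_left[of "x \<ominus>\<^bsub>M\<^esub> x'" x' y] assms by simp
  from rel_uminus[OF this] show ?thesis by (simp add: algebra_simps)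
qed

lemma rel_sum_right:
  fixes k :: nat
  assumes "x \<in> carrier M" "\<And>i. i < k \<Longrightarrow> y i \<in> carrier F"
  shows "frag_of (x, \<Oplus>\<^bsub>F\<^esub>i\<in>{..<k}. y i) - (\<Sum>i<k. frag_of (x, y i)) \<in> \<R>"
  using assms(2)
proof (induction k)
  case 0
  then show ?case using rel_zero_right assms(1) by simp
next
  case (Suc k)
  let ?s = "\<Oplus>\<^bsub>F\<^esub>i\<in>{..<k}. y i"
  have s: "?s \<in> carrier F" using Suc.prems by (intro F.finsum_closed) auto
  have "(\<Oplus>\<^bsub>F\<^esub>i\<in>{..<Suc k}. y i) = y k \<oplus>\<^bsub>F\<^esub> ?s"
    unfolding lessThan_Suc using Suc.prems by (intro F.finsum_insert) auto
  then have "frag_of (x, \<Oplus>\<^bsub>F\<^esub>i\<in>{..<Suc k}. y i) - frag_of (x, y k) - frag_of (x, ?s) \<in> \<R>"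
    using rel_right[of x "y k" ?s] s assms(1) Suc.prems by simp
  from rel_add[OF this Suc.IH] Suc.prems show ?case by (simp add: algebra_simps)
qed

abbreviation tensor_class :: "('b \<times> 'f \<Rightarrow>\<^sub>0 int) \<Rightarrow> ('b \<times> 'f \<Rightarrow>\<^sub>0 int) set" where
  "tensor_class u \<equiv> r_coset \<F> \<R> u"

lemma tensor_class_eq: "tensor_class u = (\<lambda>r. r + u) ` \<R>"
  by (auto simp: r_coset_def)

lemma tensor_class_eq_iff: "tensor_class u = tensor_class v \<longleftrightarrow> u - v \<in> \<R>"
proof
  assume "tensor_class u = tensor_class v"
  moreover have "u \<in> tensor_class u" unfolding tensor_class_eq using rel_zero by force
  ultimately obtain r where "r \<in> \<R>" "u = r + v" unfolding tensor_class_eq by blast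
  then show "u - v \<in> \<R>" by simp
next
  have sub: "tensor_class u \<subseteq> tensor_class v" if uv: "u - v \<in> \<R>" for u v
  proof
    fix w assume "w \<in> tensor_class u"
    then obtain r where "r \<in> \<R>" "w = r + u" unfolding tensor_class_eq by blast
    then have "w = (r + (u - v)) + v" "r + (u - v) \<in> \<R>" using rel_add uv by simp_all
    then show "w \<in> tensor_class v" unfolding tensor_class_eq by blast
  qed
  assume uv: "u - v \<in> \<R>"
  then have "v - u \<in> \<R>" using rel_uminus by fastforce
  with uv show "tensor_class u = tensor_class v" using sub by blast
qed

lemma tensor_group_carrier:
  "carrier (tensor_group R M F) = tensor_class ` {u. Poly_Mapping.keys u \<subseteq> carrier M \<times> carrier F}"
  unfolding tensor_group_def carrier_FactGroup by auto

lemma tensor_group_one: "\<one>\<^bsub>tensor_group R M F\<^esub> = tensor_class 0"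
  unfolding tensor_group_def tensor_class_eq by simp

text \<open>The map \<open>p \<otimes> id\<close> attached to a function \<open>p\<close> from \<open>F\<close> to \<open>R\<close>; it only descends to the part
  of the tensor product on which \<open>p\<close> is linear.\<close>

definition evaluation :: "('f \<Rightarrow> 'a) \<Rightarrow> (('b \<times> 'f \<Rightarrow>\<^sub>0 int) \<Rightarrow> 'b) \<Rightarrow> bool" where
  "evaluation p h \<longleftrightarrow> h \<in> hom \<F> (add_monoid M) \<and>
     (\<forall>x\<in>carrier M. \<forall>y\<in>carrier F. h (frag_of (x, y)) = p y \<odot>\<^bsub>M\<^esub> x)"

lemma evaluation_exists:
  assumes "p \<in> carrier F \<rightarrow> carrier R"
  shows "\<exists>h. evaluation p h"
proof -
  have "(\<lambda>(x, y). p y \<odot>\<^bsub>M\<^esub> x) ` (carrier M \<times> carrier F) \<subseteq> carrier (add_monoid M)"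
    using assms by auto
  then obtain h where "h \<in> hom \<F> (add_monoid M)"
    "\<And>z. z \<in> carrier M \<times> carrier F \<Longrightarrow> h (frag_of z) = (\<lambda>(x, y). p y \<odot>\<^bsub>M\<^esub> x) z"
    using comm_group.free_Abelian_group_universal[OF M.a_comm_group] by blast
  then show ?thesis unfolding evaluation_def by auto
qed

lemma evaluation_closed:
  "evaluation p h \<Longrightarrow> Poly_Mapping.keys u \<subseteq> carrier M \<times> carrier F \<Longrightarrow> h u \<in> carrier M"
  unfolding evaluation_def hom_def by auto

lemma evaluation_frag_of:
  "evaluation p h \<Longrightarrow> x \<in> carrier M \<Longrightarrow> y \<in> carrier F \<Longrightarrow> h (frag_of (x, y)) = p y \<odot>\<^bsub>M\<^esub> x"
  unfolding evaluation_def by blast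

lemma evaluation_diff:
  assumes "evaluation p h" "Poly_Mapping.keys u \<subseteq> carrier M \<times> carrier F"
    "Poly_Mapping.keys v \<subseteq> carrier M \<times> carrier F"
  shows "h (u - v) = h u \<ominus>\<^bsub>M\<^esub> h v"
proof -
  have "Poly_Mapping.keys (u - v) \<subseteq> carrier M \<times> carrier F"
    using keys_diff[of u v] assms by blast
  then have "h ((u - v) + v) = h (u - v) \<oplus>\<^bsub>M\<^esub> h v"
    using assms hom_mult[of h \<F> "add_monoid M" "u - v" v] by (simp add: evaluation_def)
  then show ?thesis
    using evaluation_closed[OF assms(1)] assms \<open>Poly_Mapping.keys (u - v) \<subseteq> _\<close>
    by (simp add: a_minus_def M.a_assoc M.r_neg)
qed

lemma evaluation_zero:
  assumes "evaluation p h"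
  shows "h 0 = \<zero>\<^bsub>M\<^esub>"
  using evaluation_diff[OF assms, of 0 0] evaluation_closed[OF assms, of 0]
  by (simp add: a_minus_def M.r_neg)

end

text \<open>Values in R on all of F let \<open>evaluation\<close> be formed on the whole free group;
  linearity is demanded only at elements of H, the part of F on which genuine coordinates will
  exist.\<close>

definition linear_on :: "('a, 'r) ring_scheme \<Rightarrow> ('a, 'f, 's) module_scheme \<Rightarrow> 'f set \<Rightarrow> ('f \<Rightarrow> 'a) \<Rightarrow> bool" where
  "linear_on R F H p \<longleftrightarrow> p \<in> carrier F \<rightarrow> carrier R \<and>
    (\<forall>y\<in>H. \<forall>y'\<in>H. p (y \<oplus>\<^bsub>F\<^esub> y') = p y \<oplus>\<^bsub>R\<^esub> p y') \<and>
    (\<forall>r\<in>carrier R. \<forall>y\<in>H. p (r \<odot>\<^bsub>F\<^esub> y) = r \<otimes>\<^bsub>R\<^esub> p y)"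

text \<open>A relation thus already holds over any part of \<open>F\<close> containing \<open>T\<close>, so coordinate functions
  that are linear only there respect it.\<close>

lemma (in module_pair) rel_finite_support:
  assumes "u \<in> \<R>"
  shows "\<exists>T. finite T \<and> T \<subseteq> carrier F \<and>
    (\<forall>H p h. T \<subseteq> H \<longrightarrow> linear_on R F H p \<longrightarrow> evaluation p h \<longrightarrow> h u = \<zero>\<^bsub>M\<^esub>)"
  using assms
proof (induction rule: rel_induct)
  case zero
  show ?case using evaluation_zero by blast
next
  case (left x x' y)
  \<comment> \<open>Additivity in the first argument is respected by evaluation along any R-valued
    p, so T is empty here; the next two cases record the elements at which linearity of p is
    used.\<close>
  have "h (frag_of (x \<oplus>\<^bsub>M\<^esub> x', y) - frag_of (x, y) - frag_of (x', y)) = \<zero>\<^bsub>M\<^esub>"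
    if "linear_on R F H p" "evaluation p h" for H p h
  proof -
    have p: "p y \<in> carrier R" using that left by (auto simp: linear_on_def)
    have k: "Poly_Mapping.keys (frag_of (x \<oplus>\<^bsub>M\<^esub> x', y) - frag_of (x, y)) \<subseteq> carrier M \<times> carrier F"
      using left by (auto dest!: subsetD[OF keys_diff])
    show ?thesis
      using left p k that
      by (simp add: evaluation_diff evaluation_frag_of M.smult_r_distr a_minus_def M.a_ac M.r_neg1 M.r_neg2 M.r_neg)
  qed
  then show ?case by (intro exI[of _ "{}"]) auto
next
  case (right x y y')
  have "h (frag_of (x, y \<oplus>\<^bsub>F\<^esub> y') - frag_of (x, y) - frag_of (x, y')) = \<zero>\<^bsub>M\<^esub>"
    if "{y, y'} \<subseteq> H" "linear_on R F H p" "evaluation p h" for H p h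
  proof -
    have p: "p y \<in> carrier R" "p y' \<in> carrier R" "p (y \<oplus>\<^bsub>F\<^esub> y') = p y \<oplus>\<^bsub>R\<^esub> p y'"
      using that right by (auto simp: linear_on_def)
    have k: "Poly_Mapping.keys (frag_of (x, y \<oplus>\<^bsub>F\<^esub> y') - frag_of (x, y)) \<subseteq> carrier M \<times> carrier F"
      using right by (auto dest!: subsetD[OF keys_diff])
    show ?thesis
      using right p k that
      by (simp add: evaluation_diff evaluation_frag_of M.smult_l_distr a_minus_def M.a_ac M.r_neg1 M.r_neg2 M.r_neg)
  qed
  then show ?case using right by (intro exI[of _ "{y, y'}"]) auto
next
  case (scalar r x y)
  have "h (frag_of (r \<odot>\<^bsub>M\<^esub> x, y) - frag_of (x, r \<odot>\<^bsub>F\<^esub> y)) = \<zero>\<^bsub>M\<^esub>"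
    if "{y} \<subseteq> H" "linear_on R F H p" "evaluation p h" for H p h
  proof -
    have p: "p y \<in> carrier R" "p (r \<odot>\<^bsub>F\<^esub> y) = r \<otimes>\<^bsub>R\<^esub> p y"
      using that scalar by (auto simp: linear_on_def)
    show ?thesis
      using scalar p that
      by (simp add: evaluation_diff evaluation_frag_of M.smult_assoc1[symmetric] M.R.m_comm[of r] a_minus_def M.r_neg)
  qed
  then show ?case using scalar by (intro exI[of _ "{y}"]) auto
next
  case (diff u v)
  then obtain T T' where T: "finite T" "T \<subseteq> carrier F"
      "\<And>H p h. T \<subseteq> H \<Longrightarrow> linear_on R F H p \<Longrightarrow> evaluation p h \<Longrightarrow> h u = \<zero>\<^bsub>M\<^esub>"
    and T': "finite T'" "T' \<subseteq> carrier F"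
      "\<And>H p h. T' \<subseteq> H \<Longrightarrow> linear_on R F H p \<Longrightarrow> evaluation p h \<Longrightarrow> h v = \<zero>\<^bsub>M\<^esub>" by metis
  have "h (u - v) = \<zero>\<^bsub>M\<^esub>" if "T \<union> T' \<subseteq> H" "linear_on R F H p" "evaluation p h" for H p h
    using that T(3)[of H p h] T'(3)[of H p h] evaluation_diff[of p h u v] rel_keys diff
    by (simp add: a_minus_def)
  then show ?case using T T' by (intro exI[of _ "T \<union> T'"]) auto
qed

text \<open>Over the span of the coordinate system, \<open>M \<otimes> F\<close> is a quotient of \<open>M\<^sup>k\<close>.\<close>

lemma (in module_pair) rel_expansion:
  fixes k :: nat
  assumes p: "\<And>i. i < k \<Longrightarrow> p i \<in> carrier F \<rightarrow> carrier R"
    and b: "\<And>i. i < k \<Longrightarrow> b i \<in> carrier F"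
    and H: "H \<subseteq> carrier F" "\<And>y. y \<in> H \<Longrightarrow> y = (\<Oplus>\<^bsub>F\<^esub>i\<in>{..<k}. p i y \<odot>\<^bsub>F\<^esub> b i)"
    and h: "\<And>i. i < k \<Longrightarrow> evaluation (p i) (h i)"
    and u: "Poly_Mapping.keys u \<subseteq> carrier M \<times> H"
  shows "u - (\<Sum>i<k. frag_of (h i u, b i)) \<in> \<R>"
  using u
proof (induction rule: free_Abelian_group_induct[consumes 1, case_names 1 2 3])
  case 1
  have "(\<Sum>i<k. frag_of (h i 0, b i)) \<in> \<R>"
    by (rule rel_sum) (simp add: evaluation_zero[OF h] rel_zero_left b)
  then show ?case using rel_uminus by simp
next
  case (2 u v)
  have k: "Poly_Mapping.keys u \<subseteq> carrier M \<times> carrier F" "Poly_Mapping.keys v \<subseteq> carrier M \<times> carrier F"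
    using 2(1,2) H(1) by blast+
  have "(\<Sum>i<k. frag_of (h i (u - v), b i) - (frag_of (h i u, b i) - frag_of (h i v, b i))) \<in> \<R>"
  proof (rule rel_sum)
    fix i assume "i \<in> {..<k}"
    then have i: "i < k" by simp
    show "frag_of (h i (u - v), b i) - (frag_of (h i u, b i) - frag_of (h i v, b i)) \<in> \<R>"
      unfolding evaluation_diff[OF h[OF i] k]
      by (intro rel_diff_left evaluation_closed[OF h[OF i]] k b i)
  qed
  then have "(\<Sum>i<k. frag_of (h i (u - v), b i)) - ((\<Sum>i<k. frag_of (h i u, b i)) - (\<Sum>i<k. frag_of (h i v, b i))) \<in> \<R>"
    by (simp add: sum_subtractf)
  from rel_diff[OF rel_diff[OF 2(3,4)] this] show ?case by (simp add: algebra_simps)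
next
  case (3 z)
  then obtain x y where z: "z = (x, y)" "x \<in> carrier M" "y \<in> H" by auto
  have y: "y \<in> carrier F" using z H by blast
  let ?y = "\<lambda>i. p i y \<odot>\<^bsub>F\<^esub> b i"
  have py: "p i y \<in> carrier R" if "i < k" for i using p[OF that] y by blast
  have "frag_of (x, \<Oplus>\<^bsub>F\<^esub>i\<in>{..<k}. ?y i) - (\<Sum>i<k. frag_of (x, ?y i)) \<in> \<R>"
    by (rule rel_sum_right[OF z(2)]) (use py b in auto)
  then have 1: "frag_of (x, y) - (\<Sum>i<k. frag_of (x, ?y i)) \<in> \<R>"
    using H(2)[OF z(3)] by simp
  have "(\<Sum>i<k. frag_of (p i y \<odot>\<^bsub>M\<^esub> x, b i) - frag_of (x, ?y i)) \<in> \<R>"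
    by (rule rel_sum) (use py b z rel_scalar in auto)
  moreover have "h i (frag_of z) = p i y \<odot>\<^bsub>M\<^esub> x" if "i < k" for i
    using evaluation_frag_of[OF h[OF that]] z y by simp
  ultimately have "(\<Sum>i<k. frag_of (h i (frag_of z), b i)) - (\<Sum>i<k. frag_of (x, ?y i)) \<in> \<R>"
    by (simp add: sum_subtractf)
  from rel_diff[OF 1 this] z show ?case by simp
qed

section \<open>Induced maps on tensor products\<close>

locale module_pair_hom = M: module_pair R M F + N: module_pair R N F
  for R :: "('a, 'r) ring_scheme" and M :: "('a, 'b, 'p) module_scheme"
    and N :: "('a, 'c, 'q) module_scheme" and F :: "('a, 'f, 's) module_scheme" +
  fixes g
  assumes g: "g \<in> module_hom R M N"
begin

abbreviation induced :: "('b \<times> 'f \<Rightarrow>\<^sub>0 int) \<Rightarrow> ('c \<times> 'f \<Rightarrow>\<^sub>0 int)" where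
  "induced \<equiv> frag_extend (\<lambda>(x, y). frag_of (g x, y))"

lemma g_closed: "x \<in> carrier M \<Longrightarrow> g x \<in> carrier N"
  using g by (auto simp: module_hom_def hom_def)

lemma g_add: "x \<in> carrier M \<Longrightarrow> y \<in> carrier M \<Longrightarrow> g (x \<oplus>\<^bsub>M\<^esub> y) = g x \<oplus>\<^bsub>N\<^esub> g y"
  using g by (auto simp: module_hom_def hom_def)

lemma g_smult: "r \<in> carrier R \<Longrightarrow> x \<in> carrier M \<Longrightarrow> g (r \<odot>\<^bsub>M\<^esub> x) = r \<odot>\<^bsub>N\<^esub> g x"
  using g by (auto simp: module_hom_def)

lemma g_zero: "g \<zero>\<^bsub>M\<^esub> = \<zero>\<^bsub>N\<^esub>"
  using g_smult[of "\<zero>\<^bsub>R\<^esub>" "\<zero>\<^bsub>M\<^esub>"] g_closed[of "\<zero>\<^bsub>M\<^esub>"] by simp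

lemma g_diff:
  assumes "x \<in> carrier M" "y \<in> carrier M"
  shows "g (x \<ominus>\<^bsub>M\<^esub> y) = g x \<ominus>\<^bsub>N\<^esub> g y"
proof -
  have "g ((x \<ominus>\<^bsub>M\<^esub> y) \<oplus>\<^bsub>M\<^esub> y) = g (x \<ominus>\<^bsub>M\<^esub> y) \<oplus>\<^bsub>N\<^esub> g y" using assms by (intro g_add) simp_all
  moreover have "(x \<ominus>\<^bsub>M\<^esub> y) \<oplus>\<^bsub>M\<^esub> y = x" using assms by (simp add: a_minus_def M.M.a_assoc M.M.l_neg)
  ultimately show ?thesis
    using g_closed[of "x \<ominus>\<^bsub>M\<^esub> y"] g_closed[of y] assms by (simp add: a_minus_def N.M.a_assoc N.M.r_neg)
qed

lemma induced_keys:
  assumes "Poly_Mapping.keys u \<subseteq> carrier M \<times> carrier F"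
  shows "Poly_Mapping.keys (induced u) \<subseteq> carrier N \<times> carrier F"
  using assms by (intro order_trans[OF keys_frag_extend]) (auto simp: g_closed)

lemma induced_rel:
  assumes "u \<in> M.rel"
  shows "induced u \<in> N.rel"
  using assms
proof (induction rule: M.rel_induct)
  case (diff u v)
  then show ?case by (simp add: frag_extend_diff N.rel_diff)
qed (auto simp: frag_extend_diff g_closed g_add g_smult N.rel_zero intro: N.rel_left N.rel_right N.rel_scalar)

text \<open>The image taken in \<open>tensor_map\<close> is a singleton because relations go to
  relations; from here on the tensored maps are computed on representatives.\<close>

lemma tensor_map_class:
  "tensor_map R N F g (M.tensor_class u) = N.tensor_class (induced u)"
proof -
  have "N.tensor_class (induced w) = N.tensor_class (induced u)" if "w \<in> M.tensor_class u" for w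
    using that induced_rel unfolding M.tensor_class_eq N.tensor_class_eq_iff
    by (auto simp: frag_extend_add)
  moreover have "u \<in> M.tensor_class u" unfolding M.tensor_class_eq using M.rel_zero by force
  ultimately have "(\<lambda>w. N.tensor_class (induced w)) ` M.tensor_class u = {N.tensor_class (induced u)}"
    by blast
  then show ?thesis unfolding tensor_map_def by simp
qed

text \<open>Naturality of evaluation in the module. It holds even where p is not linear, since both
  sides are additive on the free group and agree on its generators.\<close>

lemma induced_evaluation:
  assumes "M.evaluation p h" "N.evaluation p h'" "p \<in> carrier F \<rightarrow> carrier R"
    and "Poly_Mapping.keys u \<subseteq> carrier M \<times> carrier F"
  shows "h' (induced u) = g (h u)"
  using assms(4)
proof (induction rule: free_Abelian_group_induct[consumes 1, case_names 1 2 3])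
  case 1
  show ?case using assms by (simp add: M.evaluation_zero N.evaluation_zero g_zero)
next
  case (2 u v)
  then show ?case
    using assms
    by (simp add: frag_extend_diff M.evaluation_diff N.evaluation_diff induced_keys g_diff M.evaluation_closed)
next
  case (3 z)
  then obtain x y where z: "z = (x, y)" "x \<in> carrier M" "y \<in> carrier F" by auto
  then have "p y \<in> carrier R" using assms(3) by blast
  then show ?case
    using assms(1,2) z g_smult[of "p y" x] by (auto simp: M.evaluation_frag_of N.evaluation_frag_of g_closed)
qed

end

text \<open>The dual basis condition known from projective modules, localised to the subset
  H.\<close>

definition coordinate_system ::
  "('a, 'r) ring_scheme \<Rightarrow> ('a, 'f, 's) module_scheme \<Rightarrow> 'f set \<Rightarrow> nat \<Rightarrow> (nat \<Rightarrow> 'f) \<Rightarrow> (nat \<Rightarrow> 'f \<Rightarrow> 'a) \<Rightarrow> bool"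
where
  "coordinate_system R F H k b p \<longleftrightarrow> H \<subseteq> carrier F \<and>
    (\<forall>i<k. b i \<in> carrier F \<and> linear_on R F H (p i)) \<and>
    (\<forall>y\<in>H. y = (\<Oplus>\<^bsub>F\<^esub>i\<in>{..<k}. p i y \<odot>\<^bsub>F\<^esub> b i))"

text \<open>The element \<open>e\<close> with a coordinate equal to \<open>1\<close> makes \<open>x \<mapsto> x \<otimes> e\<close> injective, which turns
  flatness into faithful flatness.\<close>

theorem faithfully_flat_if_coordinates:
  fixes R :: "('a, 'r) ring_scheme" and F :: "('a, 'f, 's) module_scheme"
  assumes F: "module R F" and e: "e \<in> carrier F"
    and coords: "\<And>T. finite T \<Longrightarrow> T \<subseteq> carrier F \<Longrightarrow>
      \<exists>H k b p. T \<subseteq> H \<and> coordinate_system R F H k b p \<and> (\<exists>i<k. p i e = \<one>\<^bsub>R\<^esub>)"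
  shows "faithfully_flat TYPE('m) R F"
  unfolding faithfully_flat_def
proof (intro conjI allI impI F)
  fix L M N :: "('a, 'm) module" and f g
  assume mods: "module R L" "module R M" "module R N"
    and f: "f \<in> module_hom R L M" and g: "g \<in> module_hom R M N"
  interpret f: module_pair_hom R L M F f
    using mods F f by (simp add: module_pair_hom_def module_pair_def module_pair_hom_axioms_def)
  interpret g: module_pair_hom R M N F g
    using mods F g by (simp add: module_pair_hom_def module_pair_def module_pair_hom_axioms_def)
  let ?rM = "tensor_relations R M F" and ?rN = "tensor_relations R N F"
  let ?cM = "r_coset (free_Abelian_group (carrier M \<times> carrier F)) ?rM"
    and ?cN = "r_coset (free_Abelian_group (carrier N \<times> carrier F)) ?rN"
  let ?f' = "frag_extend (\<lambda>(x, y). frag_of (f x, y))" and ?g' = "frag_extend (\<lambda>(x, y). frag_of (g x, y))"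
  let ?im = "tensor_map R M F f ` carrier (tensor_group R L F)"
  let ?ker = "kernel (tensor_group R M F) (tensor_group R N F) (tensor_map R N F g)"
  let ?keys = "\<lambda>A u. Poly_Mapping.keys u \<subseteq> carrier A \<times> carrier F"
  have im: "?im = {?cM (?f' u) | u. ?keys L u}"
    unfolding f.M.tensor_group_carrier image_image f.tensor_map_class by blast
  have ker: "?ker = {?cM v | v. ?keys M v \<and> ?g' v \<in> ?rN}"
  proof -
    have "?cN w = \<one>\<^bsub>tensor_group R N F\<^esub> \<longleftrightarrow> w \<in> ?rN" for w
      unfolding g.N.tensor_group_one g.N.tensor_class_eq_iff by simp
    then show ?thesis
      unfolding kernel_def f.N.tensor_group_carrier using g.tensor_map_class by auto
  qed
  have coord: "\<exists>H k b p. T \<subseteq> H \<and> coordinate_system R F H k b p \<and> (\<exists>i<k. p i e = \<one>\<^bsub>R\<^esub>)"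
    if "finite T" "T \<subseteq> carrier F" for T using coords that by blast
  show "f ` carrier L = a_kernel M N g \<longleftrightarrow> ?im = ?ker"
  proof
    assume exact: "f ` carrier L = a_kernel M N g"
    have gf: "g (f x) = \<zero>\<^bsub>N\<^esub>" if "x \<in> carrier L" for x
      using exact that unfolding a_kernel_def' by blast
    have "?g' (?f' u) \<in> ?rN" if "?keys L u" for u
      using that
    proof (induction rule: free_Abelian_group_induct[consumes 1, case_names 1 2 3])
      case 1 then show ?case by (simp add: g.N.rel_zero)
    next
      case (2 u v) then show ?case by (simp add: frag_extend_diff g.N.rel_diff)
    next
      case (3 z) then show ?case by (auto simp: gf g.N.rel_zero_left)
    qed
    then have "?im \<subseteq> ?ker" unfolding im ker using f.induced_keys by blast
    moreover have "?ker \<subseteq> ?im"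
    proof
      fix C assume "C \<in> ?ker"
      then obtain v where v: "C = ?cM v" "?keys M v" "?g' v \<in> ?rN"
        unfolding ker by blast
      obtain T where T: "finite T" "T \<subseteq> carrier F"
        "\<And>H p h. T \<subseteq> H \<Longrightarrow> linear_on R F H p \<Longrightarrow> g.N.evaluation p h \<Longrightarrow> h (?g' v) = \<zero>\<^bsub>N\<^esub>"
        using g.N.rel_finite_support[OF v(3)] by blast
      \<comment> \<open>The coordinates have two tasks: T makes them respect the relation
        \<open>?g' v\<close>, and the second components of v allow v itself to be expanded.\<close>
      let ?T = "T \<union> snd ` Poly_Mapping.keys v"
      have "finite ?T" "?T \<subseteq> carrier F" using T(1,2) v(2) by auto
      from coord[OF this] obtain H k b p where H: "?T \<subseteq> H" and co: "coordinate_system R F H k b p"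
        by blast
      have lin: "linear_on R F H (p i)" and b: "b i \<in> carrier F" and pc: "p i \<in> carrier F \<rightarrow> carrier R"
        if "i < k" for i using co that by (auto simp: coordinate_system_def linear_on_def)
      have Hc: "H \<subseteq> carrier F" and Hy: "\<And>y. y \<in> H \<Longrightarrow> y = (\<Oplus>\<^bsub>F\<^esub>i\<in>{..<k}. p i y \<odot>\<^bsub>F\<^esub> b i)"
        using co unfolding coordinate_system_def by blast+
      have "\<forall>i. \<exists>h. i < k \<longrightarrow> f.N.evaluation (p i) h" using f.N.evaluation_exists pc by blast
      then obtain h where h: "\<And>i. i < k \<Longrightarrow> f.N.evaluation (p i) (h i)" by metis
      \<comment> \<open>Evaluating the relation \<open>?g' v\<close> shows that each coordinate of v
        lies in the kernel of g; exactness before tensoring lifts it to L, one coordinate at a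
        time.\<close>
      have "\<exists>l\<in>carrier L. f l = h i v" if i: "i < k" for i
      proof -
        obtain h' where h': "g.N.evaluation (p i) h'" using g.N.evaluation_exists[OF pc[OF i]] by blast
        have "g (h i v) = h' (?g' v)"
          using g.induced_evaluation[OF h[OF i] h' pc[OF i] v(2)] by simp
        also have "\<dots> = \<zero>\<^bsub>N\<^esub>" using T(3)[OF _ lin[OF i] h'] H by blast
        finally have "h i v \<in> a_kernel M N g"
          using f.N.evaluation_closed[OF h[OF i] v(2)] by (simp add: a_kernel_def')
        then show ?thesis using exact by (metis imageE)
      qed
      then obtain l where l: "\<And>i. i < k \<Longrightarrow> l i \<in> carrier L" "\<And>i. i < k \<Longrightarrow> f (l i) = h i v" by metis
      let ?u = "\<Sum>i<k. frag_of (l i, b i)"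
      have u: "?u \<in> carrier (free_Abelian_group (carrier L \<times> carrier F))"
        by (rule sum_closed_free_Abelian_group) (use l b in auto)
      have "Poly_Mapping.keys v \<subseteq> carrier M \<times> H" using v(2) H by force
      then have "v - (\<Sum>i<k. frag_of (h i v, b i)) \<in> ?rM"
        by (intro f.N.rel_expansion[of k p b H h v] pc b Hc Hy h)
      moreover have "?f' ?u = (\<Sum>i<k. frag_of (h i v, b i))"
        using l by (simp add: frag_extend_sum)
      ultimately have "C = ?cM (?f' ?u)" using v(1) f.N.tensor_class_eq_iff by simp
      then show "C \<in> ?im" unfolding im using u by auto
    qed
    ultimately show "?im = ?ker" by blast
  next
    assume exact: "?im = ?ker"
    show "f ` carrier L = a_kernel M N g"
    proof (intro equalityI subsetI)
      fix m assume "m \<in> f ` carrier L"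
      then obtain l where l: "l \<in> carrier L" "m = f l" by blast
      have fl: "f l \<in> carrier M" using l f.g_closed by blast
      have "?keys L (frag_of (l, e))" using l e by simp
      then have "?cM (?f' (frag_of (l, e))) \<in> ?ker"
        unfolding exact[symmetric] im by blast
      then obtain v where v: "?cM (frag_of (f l, e)) = ?cM v" "?g' v \<in> ?rN"
        unfolding ker by auto
      then have "?g' (frag_of (f l, e) - v) \<in> ?rN"
        using g.induced_rel f.N.tensor_class_eq_iff by blast
      from g.N.rel_add[OF this v(2)] have gr: "frag_of (g (f l), e) \<in> ?rN"
        by (simp add: frag_extend_diff)
      obtain T where T: "finite T" "T \<subseteq> carrier F"
        "\<And>H p h. T \<subseteq> H \<Longrightarrow> linear_on R F H p \<Longrightarrow> g.N.evaluation p h \<Longrightarrow> h (frag_of (g (f l), e)) = \<zero>\<^bsub>N\<^esub>"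
        using g.N.rel_finite_support[OF gr] by blast
      obtain H k b p i where H: "T \<subseteq> H" and co: "coordinate_system R F H k b p" and i: "i < k" "p i e = \<one>\<^bsub>R\<^esub>"
        using coord[OF T(1,2)] by blast
      have lin: "linear_on R F H (p i)" using co i by (simp add: coordinate_system_def)
      then have pc: "p i \<in> carrier F \<rightarrow> carrier R" by (simp add: linear_on_def)
      obtain h where h: "g.N.evaluation (p i) h" using g.N.evaluation_exists[OF pc] by blast
      have gfl: "g (f l) \<in> carrier N" using g.g_closed fl by blast
      have "g (f l) = h (frag_of (g (f l), e))"
        using g.N.evaluation_frag_of[OF h gfl e] i gfl g.N.M.smult_one by simp
      also have "\<dots> = \<zero>\<^bsub>N\<^esub>" using T(3)[OF H lin h] .
      finally show "m \<in> a_kernel M N g" using l fl by (simp add: a_kernel_def')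
    next
      fix m assume "m \<in> a_kernel M N g"
      then have m: "m \<in> carrier M" "g m = \<zero>\<^bsub>N\<^esub>" by (simp_all add: a_kernel_def')
      have "?keys M (frag_of (m, e))" using m e by simp
      moreover have "?g' (frag_of (m, e)) \<in> ?rN" using m g.N.rel_zero_left[OF e] by simp
      ultimately have "?cM (frag_of (m, e)) \<in> ?im" unfolding exact ker by blast
      then obtain u where u: "?keys L u" "?cM (frag_of (m, e)) = ?cM (?f' u)"
        unfolding im by blast
      then have mr: "frag_of (m, e) - ?f' u \<in> ?rM" using f.N.tensor_class_eq_iff by blast
      obtain T where T: "finite T" "T \<subseteq> carrier F"
        "\<And>H p h. T \<subseteq> H \<Longrightarrow> linear_on R F H p \<Longrightarrow> f.N.evaluation p h \<Longrightarrow> h (frag_of (m, e) - ?f' u) = \<zero>\<^bsub>M\<^esub>"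
        using f.N.rel_finite_support[OF mr] by blast
      obtain H k b p i where H: "T \<subseteq> H" and co: "coordinate_system R F H k b p" and i: "i < k" "p i e = \<one>\<^bsub>R\<^esub>"
        using coord[OF T(1,2)] by blast
      have lin: "linear_on R F H (p i)" using co i by (simp add: coordinate_system_def)
      then have pc: "p i \<in> carrier F \<rightarrow> carrier R" by (simp add: linear_on_def)
      obtain h where h: "f.N.evaluation (p i) h" using f.N.evaluation_exists[OF pc] by blast
      \<comment> \<open>The same coordinate, evaluated over L on the lift u of
        \<open>m \<otimes> e\<close>, yields the preimage of m.\<close>
      obtain h' where h': "f.M.evaluation (p i) h'" using f.M.evaluation_exists[OF pc] by blast
      have h'u: "h' u \<in> carrier L" using f.M.evaluation_closed[OF h' u(1)] .
      have hm: "h (frag_of (m, e)) = m"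
        using f.N.evaluation_frag_of[OF h m(1) e] i m(1) f.N.M.smult_one by simp
      have hu: "h (?f' u) = f (h' u)" using f.induced_evaluation[OF h' h pc u(1)] .
      have "m \<ominus>\<^bsub>M\<^esub> f (h' u) = \<zero>\<^bsub>M\<^esub>"
        using T(3)[OF H lin h] f.N.evaluation_diff[OF h _ f.induced_keys[OF u(1)], of "frag_of (m, e)"] m e hm hu
        by simp
      then have "m = f (h' u)"
        using m(1) f.g_closed[OF h'u] f.N.M.minus_equality[of m "\<ominus>\<^bsub>M\<^esub> f (h' u)"]
        by (simp add: a_minus_def)
      then show "m \<in> f ` carrier L" using h'u by blast
    qed
  qed
qed

section \<open>Coordinates in the completion\<close>

context one_dim_local_domain
begin

lemma completion_module: "module R F"
proof (rule moduleI[OF is_cring])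
  show "abelian_group F"
    by (rule abelian_groupI) (auto simp: S.a_ac intro: bexI[of _ "\<ominus>\<^bsub>S\<^esub> _"] S.l_neg)
qed (auto simp: S.l_distr S.r_distr S.m_assoc)

section \<open>Linear combinations and independence modulo R\<close>

primrec combination :: "nat \<Rightarrow> (nat \<Rightarrow> nat \<Rightarrow> 'a set) \<Rightarrow> (nat \<Rightarrow> 'a) \<Rightarrow> nat \<Rightarrow> 'a set" where
  "combination 0 c x = \<zero>\<^bsub>S\<^esub>"
| "combination (Suc k) c x = \<phi> (x k) \<otimes>\<^bsub>S\<^esub> c k \<oplus>\<^bsub>S\<^esub> combination k c x"

text \<open>Linear independence over R of the classes of c in S/R; the free term \<phi> r expresses
  vanishing modulo R.\<close>

definition independent_modulo :: "nat \<Rightarrow> (nat \<Rightarrow> nat \<Rightarrow> 'a set) \<Rightarrow> bool" where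
  "independent_modulo k c \<longleftrightarrow> (\<forall>r\<in>carrier R. \<forall>x\<in>UNIV \<rightarrow> carrier R.
     \<phi> r \<oplus>\<^bsub>S\<^esub> combination k c x = \<zero>\<^bsub>S\<^esub> \<longrightarrow> (\<forall>i<k. x i = \<zero>))"

definition span_with_one :: "nat \<Rightarrow> (nat \<Rightarrow> nat \<Rightarrow> 'a set) \<Rightarrow> (nat \<Rightarrow> 'a set) set" where
  "span_with_one k c = {\<phi> r \<oplus>\<^bsub>S\<^esub> combination k c x | r x. r \<in> carrier R \<and> x \<in> UNIV \<rightarrow> carrier R}"

lemma combination_closed [simp]:
  assumes "c \<in> UNIV \<rightarrow> carrier S" "x \<in> UNIV \<rightarrow> carrier R"
  shows "combination k c x \<in> carrier S"
  using assms by (induction k) (auto simp: Pi_iff)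

lemma combination_add:
  assumes "c \<in> UNIV \<rightarrow> carrier S" "x \<in> UNIV \<rightarrow> carrier R" "y \<in> UNIV \<rightarrow> carrier R"
  shows "combination k c (\<lambda>i. x i \<oplus> y i) = combination k c x \<oplus>\<^bsub>S\<^esub> combination k c y"
proof (induction k)
  case (Suc k)
  have "c k \<in> carrier S" "x k \<in> carrier R" "y k \<in> carrier R" using assms by auto
  then show ?case using Suc assms by (simp add: S.l_distr S.a_ac)
qed simp

lemma combination_smult:
  assumes "c \<in> UNIV \<rightarrow> carrier S" "x \<in> UNIV \<rightarrow> carrier R" "r \<in> carrier R"
  shows "combination k c (\<lambda>i. r \<otimes> x i) = \<phi> r \<otimes>\<^bsub>S\<^esub> combination k c x"
proof (induction k)
  case (Suc k)
  have "c k \<in> carrier S" "x k \<in> carrier R" using assms by auto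
  then show ?case using Suc assms by (simp add: S.r_distr S.m_assoc)
qed (use assms in simp)

lemma combination_uminus:
  assumes "c \<in> UNIV \<rightarrow> carrier S" "x \<in> UNIV \<rightarrow> carrier R"
  shows "combination k c (\<lambda>i. \<ominus> x i) = \<ominus>\<^bsub>S\<^esub> combination k c x"
proof (induction k)
  case (Suc k)
  have "c k \<in> carrier S" "x k \<in> carrier R" using assms by auto
  then show ?case using Suc assms by (simp add: S.l_minus S.minus_add)
qed simp

lemma combination_cong:
  assumes "\<And>i. i < k \<Longrightarrow> c i = c' i" "\<And>i. i < k \<Longrightarrow> x i = x' i"
  shows "combination k c x = combination k c' x'"
  using assms by (induction k) auto

text \<open>In S/R the family c' is c divided by d; the contributions of \<rho> collect in the
  single element s of R.\<close>

lemma combination_divide: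
  assumes "c \<in> UNIV \<rightarrow> carrier S" "c' \<in> UNIV \<rightarrow> carrier S" "\<rho> \<in> UNIV \<rightarrow> carrier R" "d \<in> carrier R"
    and c: "\<And>i. c i = \<phi> (\<rho> i) \<oplus>\<^bsub>S\<^esub> \<phi> d \<otimes>\<^bsub>S\<^esub> c' i" and x: "x \<in> UNIV \<rightarrow> carrier R"
  shows "\<exists>s\<in>carrier R. combination k c x = \<phi> s \<oplus>\<^bsub>S\<^esub> \<phi> d \<otimes>\<^bsub>S\<^esub> combination k c' x"
proof (induction k)
  case 0
  show ?case using assms(4) by (intro bexI[of _ \<zero>]) auto
next
  case (Suc k)
  then obtain s where s: "s \<in> carrier R" "combination k c x = \<phi> s \<oplus>\<^bsub>S\<^esub> \<phi> d \<otimes>\<^bsub>S\<^esub> combination k c' x"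
    by blast
  have k: "c' k \<in> carrier S" "x k \<in> carrier R" "\<rho> k \<in> carrier R" using assms by auto
  have "combination (Suc k) c x
      = \<phi> (x k \<otimes> \<rho> k \<oplus> s) \<oplus>\<^bsub>S\<^esub> \<phi> d \<otimes>\<^bsub>S\<^esub> combination (Suc k) c' x"
    using k s assms(2,4) x by (simp add: c[of k] S.r_distr S.m_lcomm S.a_ac)
  then show ?case using k s by blast
qed

text \<open>By density and divisibility \<open>S / R\<close> is a vector space over the fraction field of \<open>R\<close>; finitely
  many of its elements lie in the \<open>R\<close>-span of a linearly independent family, because a relation
  with leading coefficient \<open>d\<close> disappears once the family is divided by \<open>d\<close>.\<close>

lemma finite_subset_span:
  assumes "finite T" "T \<subseteq> carrier S"
  shows "\<exists>k c. c \<in> UNIV \<rightarrow> carrier S \<and> independent_modulo k c \<and> T \<subseteq> span_with_one k c"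
  using assms
proof (induction T rule: finite_induct)
  case empty
  show ?case by (intro exI[of _ 0] exI[of _ "\<lambda>_. \<zero>\<^bsub>S\<^esub>"]) (auto simp: independent_modulo_def)
next
  case (insert t T)
  then obtain k c where c: "c \<in> UNIV \<rightarrow> carrier S" and ind: "independent_modulo k c"
    and span: "T \<subseteq> span_with_one k c" by auto
  have t: "t \<in> carrier S" using insert.prems by blast
  show ?case
  proof (cases "\<exists>d\<in>carrier R. d \<noteq> \<zero> \<and> \<phi> d \<otimes>\<^bsub>S\<^esub> t \<in> span_with_one k c")
    case True
    then obtain d r x where d: "d \<in> carrier R" "d \<noteq> \<zero>" and r: "r \<in> carrier R" and x: "x \<in> UNIV \<rightarrow> carrier R"
      and dt: "\<phi> d \<otimes>\<^bsub>S\<^esub> t = \<phi> r \<oplus>\<^bsub>S\<^esub> combination k c x"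
      unfolding span_with_one_def by blast
    have "\<exists>\<rho> b. \<rho> \<in> carrier R \<and> b \<in> carrier S \<and> c i = \<phi> \<rho> \<oplus>\<^bsub>S\<^esub> \<phi> d \<otimes>\<^bsub>S\<^esub> b" for i
      using completion_dense[OF d, of "c i"] c by (metis UNIV_I funcset_mem)
    then obtain \<rho> c' where \<rho>c: "\<And>i. \<rho> i \<in> carrier R" "\<And>i. c' i \<in> carrier S"
      "\<And>i. c i = \<phi> (\<rho> i) \<oplus>\<^bsub>S\<^esub> \<phi> d \<otimes>\<^bsub>S\<^esub> c' i" by metis
    then have \<rho>: "\<rho> \<in> UNIV \<rightarrow> carrier R" and c': "c' \<in> UNIV \<rightarrow> carrier S" by auto
    note div = combination_divide[OF c c' \<rho> d(1) \<rho>c(3)]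
    have "independent_modulo k c'"
      unfolding independent_modulo_def
    proof (intro ballI impI)
      fix r x assume r: "r \<in> carrier R" and x: "x \<in> UNIV \<rightarrow> carrier R"
        and 0: "\<phi> r \<oplus>\<^bsub>S\<^esub> combination k c' x = \<zero>\<^bsub>S\<^esub>"
      obtain s where s: "s \<in> carrier R" "combination k c x = \<phi> s \<oplus>\<^bsub>S\<^esub> \<phi> d \<otimes>\<^bsub>S\<^esub> combination k c' x"
        using div[OF x] by blast
      have cx: "combination k c' x \<in> carrier S" using c' x by simp
      have "\<phi> (d \<otimes> r \<ominus> s) \<oplus>\<^bsub>S\<^esub> combination k c x = \<phi> d \<otimes>\<^bsub>S\<^esub> (\<phi> r \<oplus>\<^bsub>S\<^esub> combination k c' x)"
        using s d r cx by (simp add: s(2) a_minus_def S.r_distr S.a_assoc S.r_neg1 S.r_neg2)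
      also have "\<dots> = \<zero>\<^bsub>S\<^esub>" using 0 d by simp
      finally show "\<forall>i<k. x i = \<zero>"
        using ind x r s d unfolding independent_modulo_def by (meson m_closed minus_closed)
    qed
    moreover have "T \<subseteq> span_with_one k c'"
    proof
      fix y assume "y \<in> T"
      then obtain r x where r: "r \<in> carrier R" and x: "x \<in> UNIV \<rightarrow> carrier R"
        and y: "y = \<phi> r \<oplus>\<^bsub>S\<^esub> combination k c x" using span unfolding span_with_one_def by blast
      obtain s where s: "s \<in> carrier R" "combination k c x = \<phi> s \<oplus>\<^bsub>S\<^esub> \<phi> d \<otimes>\<^bsub>S\<^esub> combination k c' x"
        using div[OF x] by blast
      have "y = \<phi> (r \<oplus> s) \<oplus>\<^bsub>S\<^esub> combination k c' (\<lambda>i. d \<otimes> x i)"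
        using r s d c' x by (simp add: y combination_smult S.a_assoc)
      moreover have "(\<lambda>i. d \<otimes> x i) \<in> UNIV \<rightarrow> carrier R" using x d by auto
      ultimately show "y \<in> span_with_one k c'" unfolding span_with_one_def using r s by blast
    qed
    moreover have "t \<in> span_with_one k c'"
    proof -
      obtain s where s: "s \<in> carrier R" "combination k c x = \<phi> s \<oplus>\<^bsub>S\<^esub> \<phi> d \<otimes>\<^bsub>S\<^esub> combination k c' x"
        using div[OF x] by blast
      let ?z = "combination k c' x"
      have z: "?z \<in> carrier S" using c' x by simp
      have rs: "r \<oplus> s \<in> carrier R" using r s by simp
      have dt': "\<phi> d \<otimes>\<^bsub>S\<^esub> t = \<phi> d \<otimes>\<^bsub>S\<^esub> ?z \<oplus>\<^bsub>S\<^esub> \<phi> (r \<oplus> s)"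
        using dt s r d z by (simp add: S.a_ac)
      have tz: "\<phi> d \<otimes>\<^bsub>S\<^esub> (t \<ominus>\<^bsub>S\<^esub> ?z) = \<phi> d \<otimes>\<^bsub>S\<^esub> t \<ominus>\<^bsub>S\<^esub> \<phi> d \<otimes>\<^bsub>S\<^esub> ?z"
        using t z d by (simp add: a_minus_def S.r_distr S.r_minus)
      also have "\<dots> = \<phi> (r \<oplus> s)" unfolding dt' using d z rs by (intro S.add_diff_cancel) auto
      finally have eq: "\<phi> d \<otimes>\<^bsub>S\<^esub> (t \<ominus>\<^bsub>S\<^esub> ?z) = \<phi> (r \<oplus> s)" .
      \<comment> \<open>An element of R divisible by d in S is divisible by d in R; torsion-freeness
        then cancels d and leaves t equal to \<phi> y plus a combination of c'.\<close>
      obtain y where y: "y \<in> carrier R" "r \<oplus> s = d \<otimes> y"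
        using completion_divides[OF rs d, of "t \<ominus>\<^bsub>S\<^esub> ?z"] eq t z by auto
      have "\<phi> d \<otimes>\<^bsub>S\<^esub> (t \<ominus>\<^bsub>S\<^esub> ?z \<ominus>\<^bsub>S\<^esub> \<phi> y) = \<phi> d \<otimes>\<^bsub>S\<^esub> (t \<ominus>\<^bsub>S\<^esub> ?z) \<ominus>\<^bsub>S\<^esub> \<phi> (d \<otimes> y)"
        using t z d y by (simp add: a_minus_def S.r_distr S.r_minus)
      also have "\<dots> = \<zero>\<^bsub>S\<^esub>" using eq y d by (simp add: a_minus_def S.r_neg)
      finally have "t \<ominus>\<^bsub>S\<^esub> ?z \<ominus>\<^bsub>S\<^esub> \<phi> y = \<zero>\<^bsub>S\<^esub>"
        using completion_torsion_free[OF d] t z y by (meson S.minus_closed \<phi>.hom_closed)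
      then have "t \<ominus>\<^bsub>S\<^esub> ?z = \<phi> y" using t z y by simp
      then have "t = \<phi> y \<oplus>\<^bsub>S\<^esub> ?z" using S.add_diff_cancel(3)[OF z t] by simp
      then show ?thesis unfolding span_with_one_def using y x by blast
    qed
    ultimately show ?thesis using c' by blast
  next
    case False
    let ?c = "c(k := t)"
    have c': "?c \<in> UNIV \<rightarrow> carrier S" using c t by auto
    have comb: "combination (Suc k) ?c x = \<phi> (x k) \<otimes>\<^bsub>S\<^esub> t \<oplus>\<^bsub>S\<^esub> combination k c x" for x
      using combination_cong[of k ?c c x x] by simp
    have "independent_modulo (Suc k) ?c"
      unfolding independent_modulo_def
    proof (intro ballI impI)
      fix r x assume r: "r \<in> carrier R" and x: "x \<in> UNIV \<rightarrow> carrier R"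
        and 0: "\<phi> r \<oplus>\<^bsub>S\<^esub> combination (Suc k) ?c x = \<zero>\<^bsub>S\<^esub>"
      have xk: "x k \<in> carrier R" and cx: "combination k c x \<in> carrier S" using x c by auto
      have 1: "\<phi> (x k) \<otimes>\<^bsub>S\<^esub> t \<oplus>\<^bsub>S\<^esub> (\<phi> r \<oplus>\<^bsub>S\<^esub> combination k c x) = \<zero>\<^bsub>S\<^esub>"
        using 0 unfolding comb using r xk cx t by (simp add: S.a_lcomm)
      have "x k = \<zero>"
      proof (rule ccontr)
        assume nz: "x k \<noteq> \<zero>"
        have "\<phi> (x k) \<otimes>\<^bsub>S\<^esub> t = \<ominus>\<^bsub>S\<^esub> (\<phi> r \<oplus>\<^bsub>S\<^esub> combination k c x)"
          using S.minus_equality[OF 1] r xk cx t by simp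
        also have "\<dots> = \<phi> (\<ominus> r) \<oplus>\<^bsub>S\<^esub> combination k c (\<lambda>i. \<ominus> x i)"
          using r cx x c by (simp add: S.minus_add combination_uminus)
        finally have "\<phi> (x k) \<otimes>\<^bsub>S\<^esub> t = \<phi> (\<ominus> r) \<oplus>\<^bsub>S\<^esub> combination k c (\<lambda>i. \<ominus> x i)" .
        moreover have "(\<lambda>i. \<ominus> x i) \<in> UNIV \<rightarrow> carrier R" using x by auto
        ultimately have "\<phi> (x k) \<otimes>\<^bsub>S\<^esub> t \<in> span_with_one k c"
          unfolding span_with_one_def using r by (metis (mono_tags, lifting) a_inv_closed mem_Collect_eq)
        then show False using False nz xk by blast
      qed
      moreover from this have "\<phi> r \<oplus>\<^bsub>S\<^esub> combination k c x = \<zero>\<^bsub>S\<^esub>" using 1 r cx t by simp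
      then have "\<forall>i<k. x i = \<zero>" using ind r x unfolding independent_modulo_def by blast
      ultimately show "\<forall>i<Suc k. x i = \<zero>" by (auto simp: less_Suc_eq)
    qed
    moreover have "T \<subseteq> span_with_one (Suc k) ?c"
    proof
      fix y assume "y \<in> T"
      then obtain r x where r: "r \<in> carrier R" and x: "x \<in> UNIV \<rightarrow> carrier R"
        and y: "y = \<phi> r \<oplus>\<^bsub>S\<^esub> combination k c x" using span unfolding span_with_one_def by blast
      \<comment> \<open>The value \<open>x k\<close> was arbitrary for the old family, which uses
        only indices below k; now that index k carries t it has to be zero.\<close>
      have "combination k c (x(k := \<zero>)) = combination k c x" by (rule combination_cong) auto
      then have "y = \<phi> r \<oplus>\<^bsub>S\<^esub> combination (Suc k) ?c (x(k := \<zero>))"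
        unfolding comb using y t c x by simp
      moreover have "x(k := \<zero>) \<in> UNIV \<rightarrow> carrier R" using x by auto
      ultimately show "y \<in> span_with_one (Suc k) ?c" unfolding span_with_one_def using r by blast
    qed
    moreover have "t \<in> span_with_one (Suc k) ?c"
    proof -
      let ?x = "(\<lambda>_. \<zero>)(k := \<one>)"
      \<comment> \<open>Coefficients written as zero times zero let \<open>combination_smult\<close>
        pull out a zero scalar, which makes the combination vanish.\<close>
      have "combination k c ?x = combination k c (\<lambda>_. \<zero> \<otimes> \<zero>)" by (rule combination_cong) auto
      also have "\<dots> = \<zero>\<^bsub>S\<^esub>" using combination_smult[of c "\<lambda>_. \<zero>" \<zero> k] c by (simp del: r_null l_null)
      finally have "t = \<phi> \<zero> \<oplus>\<^bsub>S\<^esub> combination (Suc k) ?c ?x" unfolding comb using t by simp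
      moreover have "?x \<in> UNIV \<rightarrow> carrier R" by auto
      ultimately show ?thesis unfolding span_with_one_def by blast
    qed
    ultimately show ?thesis using c' by blast
  qed
qed

section \<open>Coordinate functions on the span\<close>

lemma completion_finsum:
  assumes "c \<in> UNIV \<rightarrow> carrier S" "x \<in> UNIV \<rightarrow> carrier R"
  shows "(\<Oplus>\<^bsub>F\<^esub>i\<in>{..<k}. x i \<odot>\<^bsub>F\<^esub> c i) = combination k c x"
proof -
  interpret F: module R F by (rule completion_module)
  show ?thesis
  proof (induction k)
    case (Suc k)
    have "(\<Oplus>\<^bsub>F\<^esub>i\<in>insert k {..<k}. x i \<odot>\<^bsub>F\<^esub> c i)
        = x k \<odot>\<^bsub>F\<^esub> c k \<oplus>\<^bsub>F\<^esub> (\<Oplus>\<^bsub>F\<^esub>i\<in>{..<k}. x i \<odot>\<^bsub>F\<^esub> c i)"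
      using assms by (intro F.finsum_insert) (auto simp: Pi_iff)
    then show ?case using Suc by (simp add: lessThan_Suc)
  qed simp
qed

text \<open>Placing 1 after a family independent modulo R gives a basis of the span: independence
  determines the first k coefficients, and injectivity of \<phi> the coefficient of 1. The
  coordinate at position k is the one that takes the value 1 at 1.\<close>

lemma completion_coordinates:
  assumes "finite T" "T \<subseteq> carrier S"
  shows "\<exists>H k b p. T \<subseteq> H \<and> coordinate_system R F H k b p \<and> (\<exists>i<k. p i \<one>\<^bsub>S\<^esub> = \<one>)"
proof -
  obtain k c where c: "c \<in> UNIV \<rightarrow> carrier S" and ind: "independent_modulo k c"
    and T: "T \<subseteq> span_with_one k c" using finite_subset_span[OF assms] by blast
  let ?b = "c(k := \<one>\<^bsub>S\<^esub>)" and ?H = "span_with_one k c"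
  have b: "?b \<in> UNIV \<rightarrow> carrier S" using c by auto
  have comb: "combination (Suc k) ?b z = \<phi> (z k) \<oplus>\<^bsub>S\<^esub> combination k c z" if "z \<in> UNIV \<rightarrow> carrier R" for z
    using combination_cong[of k ?b c z z] that by (simp add: Pi_iff)
  have mem: "combination (Suc k) ?b z \<in> ?H" if "z \<in> UNIV \<rightarrow> carrier R" for z
    using comb[OF that] that unfolding span_with_one_def by blast
  have ex: "\<exists>z. z \<in> UNIV \<rightarrow> carrier R \<and> y = combination (Suc k) ?b z" if "y \<in> ?H" for y
  proof -
    obtain r x where rx: "r \<in> carrier R" "x \<in> UNIV \<rightarrow> carrier R" "y = \<phi> r \<oplus>\<^bsub>S\<^esub> combination k c x"
      using \<open>y \<in> ?H\<close> unfolding span_with_one_def by blast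
    have z: "x(k := r) \<in> UNIV \<rightarrow> carrier R" using rx by auto
    have "combination k c (x(k := r)) = combination k c x" by (rule combination_cong) auto
    then have "y = combination (Suc k) ?b (x(k := r))" using comb[OF z] rx(3) by simp
    with z show ?thesis by blast
  qed
  have uniq: "z i = z' i" if "z \<in> UNIV \<rightarrow> carrier R" "z' \<in> UNIV \<rightarrow> carrier R"
    "combination (Suc k) ?b z = combination (Suc k) ?b z'" "i < Suc k" for z z' i
  proof -
    let ?w = "\<lambda>i. z i \<oplus> \<ominus> z' i"
    have z: "z i \<in> carrier R" "z' i \<in> carrier R" for i using that by auto
    have m: "(\<lambda>i. \<ominus> z' i) \<in> UNIV \<rightarrow> carrier R" and w: "?w \<in> UNIV \<rightarrow> carrier R" using z by auto
    have "combination (Suc k) ?b ?w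
        = combination (Suc k) ?b z \<oplus>\<^bsub>S\<^esub> \<ominus>\<^bsub>S\<^esub> combination (Suc k) ?b z'"
      using combination_add[OF b that(1) m, of "Suc k"] combination_uminus[OF b that(2), of "Suc k"]
      by (simp only:)
    then have "combination (Suc k) ?b ?w = \<zero>\<^bsub>S\<^esub>"
      using that(3) S.r_neg[OF combination_closed[OF b that(2), of "Suc k"]] by (simp only:)
    then have 0: "\<phi> (?w k) \<oplus>\<^bsub>S\<^esub> combination k c ?w = \<zero>\<^bsub>S\<^esub>" using comb[OF w] by simp
    moreover have "?w k \<in> carrier R" using w by (rule funcset_mem) simp
    ultimately have wi: "?w i = \<zero>" if "i < k" for i
      using ind w \<open>i < k\<close> unfolding independent_modulo_def by blast
    have "combination k c ?w = combination k c (\<lambda>_. \<zero> \<otimes> \<zero>)" by (rule combination_cong) (auto simp: wi)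
    also have "\<dots> = \<zero>\<^bsub>S\<^esub>" using combination_smult[of c "\<lambda>_. \<zero>" \<zero> k] c by (simp del: r_null l_null)
    finally have "\<phi> (?w k) = \<zero>\<^bsub>S\<^esub>" using 0 \<open>?w k \<in> carrier R\<close> \<phi>.hom_closed[of "?w k"] by (simp only: S.r_zero)
    then have "?w k = \<zero>" using to_completion_eq_zero_iff[OF \<open>?w k \<in> carrier R\<close>] by blast
    then have "?w i = \<zero>" using wi \<open>i < Suc k\<close> by (auto simp: less_Suc_eq)
    then show ?thesis using minus_equality[of "z i" "\<ominus> z' i"] z by simp
  qed
  \<comment> \<open>The zero family off \<open>?H\<close> keeps the coordinates R-valued on all of
    S. Coefficients beyond index k are left open by the choice, so equalities are claimed below
    \<open>Suc k\<close> only.\<close>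
  define co where "co y = (if y \<in> ?H
    then SOME z. z \<in> UNIV \<rightarrow> carrier R \<and> y = combination (Suc k) ?b z else (\<lambda>_. \<zero>))" for y
  have co: "co y \<in> UNIV \<rightarrow> carrier R" "y = combination (Suc k) ?b (co y)" if "y \<in> ?H" for y
    using someI_ex[OF ex[OF that]] that by (simp_all add: co_def)
  have coc: "co y i \<in> carrier R" for y i
    using co(1)[of y] by (cases "y \<in> ?H") (auto simp: co_def)
  have co_comb: "co (combination (Suc k) ?b z) i = z i" if "z \<in> UNIV \<rightarrow> carrier R" "i < Suc k" for z i
    using uniq[OF co(1)[OF mem[OF that(1)]] that(1) co(2)[OF mem[OF that(1)], symmetric] that(2)] .
  have "linear_on R F ?H (\<lambda>y. co y i)" if i: "i < Suc k" for i
    unfolding linear_on_def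
  proof (intro conjI ballI)
    show "(\<lambda>y. co y i) \<in> carrier F \<rightarrow> carrier R" using coc by auto
  next
    fix y y' assume y: "y \<in> ?H" "y' \<in> ?H"
    have z: "(\<lambda>i. co y i \<oplus> co y' i) \<in> UNIV \<rightarrow> carrier R" using coc by auto
    have "y \<oplus>\<^bsub>F\<^esub> y' = combination (Suc k) ?b (\<lambda>i. co y i \<oplus> co y' i)"
      using combination_add[OF b co(1)[OF y(1)] co(1)[OF y(2)], of "Suc k"]
        co(2)[OF y(1)] co(2)[OF y(2)] by (simp only: module_simps)
    then show "co (y \<oplus>\<^bsub>F\<^esub> y') i = co y i \<oplus> co y' i" using co_comb[OF z i] by (simp only:)
  next
    fix r y assume y: "r \<in> carrier R" "y \<in> ?H"
    have z: "(\<lambda>i. r \<otimes> co y i) \<in> UNIV \<rightarrow> carrier R" using coc y by auto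
    have "r \<odot>\<^bsub>F\<^esub> y = combination (Suc k) ?b (\<lambda>i. r \<otimes> co y i)"
      using combination_smult[OF b co(1)[OF y(2)] y(1), of "Suc k"] co(2)[OF y(2)]
      by (simp only: module_simps)
    then show "co (r \<odot>\<^bsub>F\<^esub> y) i = r \<otimes> co y i" using co_comb[OF z i] by (simp only:)
  qed
  moreover have "?b i \<in> carrier F" for i using b by (auto simp: Pi_iff)
  moreover have "?H \<subseteq> carrier F"
    using c unfolding span_with_one_def by auto
  moreover have "y = (\<Oplus>\<^bsub>F\<^esub>i\<in>{..<Suc k}. co y i \<odot>\<^bsub>F\<^esub> ?b i)" if "y \<in> ?H" for y
    using completion_finsum[OF b co(1)[OF that], of "Suc k"] co(2)[OF that] by (simp only:)
  ultimately have sys: "coordinate_system R F ?H (Suc k) ?b (\<lambda>i y. co y i)"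
    unfolding coordinate_system_def by blast
  have "co \<one>\<^bsub>S\<^esub> k = \<one>"
  proof -
    let ?z = "(\<lambda>_. \<zero>)(k := \<one>)"
    have z: "?z \<in> UNIV \<rightarrow> carrier R" by auto
    have "combination k c ?z = combination k c (\<lambda>_. \<zero> \<otimes> \<zero>)" by (rule combination_cong) auto
    also have "\<dots> = \<zero>\<^bsub>S\<^esub>" using combination_smult[of c "\<lambda>_. \<zero>" \<zero> k] c by (simp del: r_null l_null)
    finally have "combination (Suc k) ?b ?z = \<one>\<^bsub>S\<^esub>" unfolding comb[OF z] by simp
    then show ?thesis using co_comb[OF z, of k] by simp
  qed
  then show ?thesis using T sys by blast
qed

lemma completion_faithfully_flat: "faithfully_flat TYPE('m) R F"
proof (rule faithfully_flat_if_coordinates[OF completion_module])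
  show "\<one>\<^bsub>S\<^esub> \<in> carrier F" by simp
qed (use completion_coordinates in simp)

lemma gaussian_if_unit_multiples:
  assumes unit_multiples
  shows "gaussian TYPE('m) R S \<phi>"
  unfolding gaussian_def
  using ohm_rush_if_unit_multiples[OF assms] completion_faithfully_flat content_mult_if_unit_multiples[OF assms]
  by blast

end

theorem corollary2p10:
  fixes R :: "('a, 'r) ring_scheme" and \<mm> :: "'a set"
  assumes "noetherian_ring R" and "domain R" and "local_ring R \<mm>" and "krull_dim R = 1"
  shows "(gaussian TYPE('m) R (adic_completion R \<mm>) (completion_map R \<mm>) \<longleftrightarrow>
            ohm_rush R (adic_completion R \<mm>) (completion_map R \<mm>)) \<and>
         (ohm_rush R (adic_completion R \<mm>) (completion_map R \<mm>) \<longleftrightarrow>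
            analytically_irreducible R \<mm>)"
proof -
  interpret one_dim_local_domain R \<mm>
    by (intro one_dim_local_domain.intro noetherian_domain.intro one_dim_local_domain_axioms.intro assms)
  show ?thesis
    unfolding analytically_irreducible_def
  proof (intro conjI iffI)
    assume "gaussian TYPE('m) R (adic_completion R \<mm>) (completion_map R \<mm>)"
    then show "ohm_rush R (adic_completion R \<mm>) (completion_map R \<mm>)"
      unfolding gaussian_def by (rule conjunct1)
  \<comment> \<open>Each remaining implication passes through \<open>unit_multiples\<close>: one
    rule leads from it to the conclusion, the next leads from the assumption to it.\<close>
  qed (rule gaussian_if_unit_multiples ohm_rush_if_unit_multiples domain_if_unit_multiples,
      erule unit_multiples_if_ohm_rush unit_multiples_if_domain)+
qed

end
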